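(* For every integer $\ell\geq 6$ we have $p_\ell(n) \leq \left(\frac{1}{4}+o(1)\right)n^2$ for all sufficiently large $n$, where the $o(1)$ term tends to $0$ as $n\to\infty$ with $\ell$ fixed.
   Context: All graphs are finite and simple. The length of a path is its number of edges. For positive integers $\ell$ and $n$, $p_\ell(n)$ denotes the maximum number of edges in an $n$-vertex graph $G$ that contains no two distinct vertices of equal degree connected by a path of length $\ell$. *)

theory Defs
  imports Complex_Main
begin

definition simple_graph :: "'a set \<Rightarrow> 'a set set \<Rightarrow> bool" where
  "simple_graph V E \<longleftrightarrow> finite V \<and> E \<subseteq> {e. e \<subseteq> V \<and> card e = 2}"

definition degree :: "'a set set \<Rightarrow> 'a \<Rightarrow> nat" where
  "degree E v = card {e \<in> E. v \<in> e}"

text \<open>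
  A path is given by its list of vertices, which are pairwise distinct; its length is the number of
  edges, one less than the number of vertices.
\<close>

definition is_path :: "'a set \<Rightarrow> 'a set set \<Rightarrow> 'a list \<Rightarrow> bool" where
  "is_path V E xs \<longleftrightarrow> xs \<noteq> [] \<and> distinct xs \<and> set xs \<subseteq> V \<and>
     (\<forall>i. Suc i < length xs \<longrightarrow> {xs ! i, xs ! Suc i} \<in> E)"

definition path_length :: "'a list \<Rightarrow> nat" where
  "path_length xs = length xs - 1"

definition joined_by_path :: "'a set \<Rightarrow> 'a set set \<Rightarrow> nat \<Rightarrow> 'a \<Rightarrow> 'a \<Rightarrow> bool" where
  "joined_by_path V E l u v \<longleftrightarrow>
     (\<exists>xs. is_path V E xs \<and> path_length xs = l \<and> hd xs = u \<and> last xs = v)"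

definition no_equal_degree_path :: "nat \<Rightarrow> 'a set \<Rightarrow> 'a set set \<Rightarrow> bool" where
  "no_equal_degree_path l V E \<longleftrightarrow>
     \<not> (\<exists>u\<in>V. \<exists>v\<in>V. u \<noteq> v \<and> degree E u = degree E v \<and> joined_by_path V E l u v)"

text \<open>
  Every finite graph is isomorphic to one whose vertices are natural numbers, so it is enough to
  range over those. The set of edge counts is finite and nonempty (lemmas below), so that
  \<open>Max\<close> is a true maximum.
\<close>

definition edge_counts :: "nat \<Rightarrow> nat \<Rightarrow> nat set" where
  "edge_counts l n = {card E | (V :: nat set) E.
     simple_graph V E \<and> card V = n \<and> no_equal_degree_path l V E}"

definition max_edges :: "nat \<Rightarrow> nat \<Rightarrow> nat" where
  "max_edges l n = Max (edge_counts l n)"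

lemma finite_edge_counts: "finite (edge_counts l n)"
proof (rule finite_subset)
  show "edge_counts l n \<subseteq> {..n choose 2}"
  proof
    fix m assume "m \<in> edge_counts l n"
    then obtain V :: "nat set" and E where m: "m = card E" and g: "simple_graph V E"
      and n: "card V = n"
      unfolding edge_counts_def by blast
    from g have fin: "finite V" and sub: "E \<subseteq> {e. e \<subseteq> V \<and> card e = 2}"
      by (auto simp: simple_graph_def)
    have "finite {e. e \<subseteq> V \<and> card e = 2}"
      using fin by simp
    then have "card E \<le> card {e. e \<subseteq> V \<and> card e = 2}"
      using sub by (rule card_mono)
    also have "\<dots> = n choose 2"
      using n_subsets[OF fin] n by simp
    finally show "m \<in> {..n choose 2}"
      using m by simp
  qed
qed simp

lemma edge_counts_nonempty:
  assumes "l \<ge> 1"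
  shows "edge_counts l n \<noteq> {}"
proof -
  have "\<not> (is_path {..<n} {} xs \<and> path_length xs = l)" for xs :: "nat list"
  proof
    assume *: "is_path {..<n} {} xs \<and> path_length xs = l"
    then have "Suc 0 < length xs"
      using assms by (auto simp: path_length_def)
    with * show False
      unfolding is_path_def by blast
  qed
  then have "no_equal_degree_path l {..<n} {}"
    unfolding no_equal_degree_path_def joined_by_path_def by blast
  moreover have "simple_graph {..<n} {}"
    by (simp add: simple_graph_def)
  ultimately have "card ({} :: nat set set) \<in> edge_counts l n"
    unfolding edge_counts_def using card_lessThan by blast
  then show ?thesis by blast
qed

end

theory Submission
  imports Defs
begin

text \<open>
  Delete few edges so that any two adjacent pairs \<open>u x\<close>, \<open>y v\<close> of the remaining graph with many walks
  of length \<open>l - 2\<close> from \<open>x\<close> to \<open>y\<close> extend to a path of length \<open>l\<close> from \<open>u\<close> to \<open>v\<close>: this is possible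
  because, by weak regularity, the vertices fall into boundedly many classes within which the
  codegree functions \<open>v \<mapsto> codeg(x, v)\<close> are almost equal in \<open>L\<^sup>1\<close>, and one may keep only the edges
  \<open>u x\<close> for which \<open>u\<close> has many neighbours in the class of \<open>x\<close>; the middle part of the walk, of length
  at least 4, then depends on \<open>x\<close> and \<open>y\<close> only through their classes. This is where \<open>l \<ge> 6\<close> enters.

  Now let \<open>x\<close> have maximum degree \<open>M\<close> in the remaining graph, and let \<open>W\<close> be the set of vertices with
  many neighbours in \<open>N(x)\<close>. If \<open>W\<close> spans few edges, then almost all edges \<open>u v\<close> satisfy
  \<open>d(u) + d(v) \<le> n + o(n)\<close> and Mantel's argument bounds the number of edges. If \<open>W\<close> spans many edges,
  there are many closed walks of length \<open>l - 2\<close> at \<open>x\<close>, so the vertices of \<open>N(x)\<close> have distinct degrees,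
  essentially at most \<open>M\<close>, and the degree sum is at most \<open>M\<^sup>2 / 2 + (n - M) M + o(n\<^sup>2)\<close>.
\<close>

section \<open>Walks and paths\<close>

text \<open>Adjacency is a relation and the vertex set a separate argument, so that a graph with
  fewer edges is another relation and an induced subgraph another set.\<close>

definition nbrs :: "'a set \<Rightarrow> ('a \<Rightarrow> 'a \<Rightarrow> bool) \<Rightarrow> 'a \<Rightarrow> 'a set" where
  "nbrs V R u = {v \<in> V. R u v}"

text \<open>For \<open>u\<close> and \<open>v\<close> in \<open>V\<close>, the \<open>(u, v)\<close>
  entry of the \<open>k\<close>-th power of the adjacency matrix.\<close>

primrec walks :: "'a set \<Rightarrow> ('a \<Rightarrow> 'a \<Rightarrow> bool) \<Rightarrow> nat \<Rightarrow> 'a \<Rightarrow> 'a \<Rightarrow> real" where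
  "walks V R 0 u v = of_bool (u = v)"
| "walks V R (Suc k) u v = (\<Sum>w\<in>nbrs V R u. walks V R k w v)"

lemma nbrs_subset: "nbrs V R u \<subseteq> V"
  by (auto simp: nbrs_def)

lemma mem_nbrs: "v \<in> nbrs V R u \<longleftrightarrow> v \<in> V \<and> R u v"
  by (auto simp: nbrs_def)

lemma finite_nbrs [simp]: "finite V \<Longrightarrow> finite (nbrs V R u)"
  by (simp add: nbrs_def)

lemma card_nbrs_le: "finite V \<Longrightarrow> card (nbrs V R u) \<le> card V"
  by (simp add: card_mono nbrs_subset)

lemma card_nbrs_sum: "finite V \<Longrightarrow> real (card (nbrs V R u)) = (\<Sum>v\<in>V. of_bool (R u v))"
  by (simp add: nbrs_def of_bool_def sum.If_cases Int_def)

lemma sum_nbrs: "finite V \<Longrightarrow> (\<Sum>w\<in>nbrs V R u. h w) = (\<Sum>w\<in>V. of_bool (R u w) * (h w :: real))"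
  unfolding nbrs_def by (subst sum.inter_filter, simp, rule sum.cong) auto

lemma walks_nonneg: "0 \<le> walks V R k u v"
  by (induction k arbitrary: u) (auto intro: sum_nonneg)

text \<open>A walk of length \<open>Suc k\<close> with fixed ends has only \<open>k\<close> free
  inner vertices.\<close>

lemma walks_Suc_le:
  assumes "finite V"
  shows "walks V R (Suc k) u v \<le> real (card V) ^ k"
proof (induction k arbitrary: u)
  case 0
  have "walks V R (Suc 0) u v = (\<Sum>w\<in>nbrs V R u. if w = v then 1 else 0)"
    by (simp add: of_bool_def)
  also have "\<dots> \<le> 1"
    using assms by (simp add: sum.delta)
  finally show ?case by simp
next
  case (Suc k)
  have "walks V R (Suc (Suc k)) u v \<le> (\<Sum>w\<in>nbrs V R u. real (card V) ^ k)"
    unfolding walks.simps(2)[of V R "Suc k"] by (intro sum_mono Suc)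
  also have "\<dots> \<le> real (card V) * real (card V) ^ k"
    using card_nbrs_le[OF assms, of R u] by (simp add: mult_right_mono)
  finally show ?case by simp
qed

lemma walks_mono:
  assumes "finite V" "\<And>u v. R' u v \<Longrightarrow> R u v"
  shows "walks V R' k u v \<le> walks V R k u v"
proof (induction k arbitrary: u)
  case (Suc k)
  have "walks V R' (Suc k) u v \<le> (\<Sum>w\<in>nbrs V R' u. walks V R k w v)"
    by (simp add: sum_mono Suc)
  also have "\<dots> \<le> walks V R (Suc k) u v"
    unfolding walks.simps using assms
    by (intro sum_mono2) (auto simp: nbrs_def walks_nonneg)
  finally show ?case .
qed simp

lemma walks_add:
  assumes "finite V" "u \<in> V"
  shows "walks V R (j + k) u v = (\<Sum>w\<in>V. walks V R j u w * walks V R k w v)"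
  using assms(2)
proof (induction j arbitrary: u)
  case 0
  then show ?case using assms(1) by (simp add: of_bool_def if_distrib[of "\<lambda>x. x * _"] cong: if_cong)
next
  case (Suc j)
  have "walks V R (Suc j + k) u v
      = (\<Sum>z\<in>nbrs V R u. \<Sum>w\<in>V. walks V R j z w * walks V R k w v)"
    using Suc.IH by (auto intro!: sum.cong simp: mem_nbrs)
  also have "\<dots> = (\<Sum>w\<in>V. \<Sum>z\<in>nbrs V R u. walks V R j z w * walks V R k w v)"
    by (rule sum.swap)
  finally show ?case by (simp add: sum_distrib_right)
qed

lemma walks_1: "finite V \<Longrightarrow> v \<in> V \<Longrightarrow> walks V R (Suc 0) u v = of_bool (R u v)"
  by (simp add: of_bool_def sum.delta mem_nbrs)

lemma walks_sym:
  assumes "finite V" "symp R" "u \<in> V" "v \<in> V"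
  shows "walks V R k u v = walks V R k v u"
  using assms(3,4)
proof (induction k arbitrary: u v)
  case (Suc k)
  have "walks V R (Suc k) u v = (\<Sum>w\<in>V. walks V R k u w * walks V R (Suc 0) w v)"
    using walks_add[OF assms(1) Suc.prems(1), of R k "Suc 0" v] by simp
  also have "\<dots> = (\<Sum>w\<in>V. walks V R (Suc 0) v w * walks V R k w u)"
  proof (rule sum.cong[OF refl])
    fix w assume w: "w \<in> V"
    have "R w v = R v w" using assms(2) by (auto dest: sympD)
    with w Suc show "walks V R k u w * walks V R (Suc 0) w v = walks V R (Suc 0) v w * walks V R k w u"
      using walks_1[OF assms(1)] by (simp del: walks.simps)
  qed
  also have "\<dots> = walks V R (Suc k) v u"
    using walks_add[OF assms(1) Suc.prems(2), of R "Suc 0" k u] by simp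
  finally show ?case .
qed (auto)

lemma walks_2:
  assumes "finite V"
  shows "walks V R 2 u v = real (card {w \<in> nbrs V R u. v \<in> nbrs V R w})"
proof -
  have "walks V R 2 u v = (\<Sum>w\<in>nbrs V R u. of_bool (v \<in> nbrs V R w))"
    using assms by (simp add: numeral_2_eq_2 of_bool_def sum.delta)
  then show ?thesis
    using assms by (simp add: of_bool_def sum.If_cases Int_def)
qed

abbreviation adj :: "'a set set \<Rightarrow> 'a \<Rightarrow> 'a \<Rightarrow> bool" where
  "adj E \<equiv> \<lambda>u v. {u, v} \<in> E"

lemma is_path_Cons:
  assumes "is_path V E xs" "u \<in> V" "u \<notin> set xs" "{u, hd xs} \<in> E"
  shows "is_path V E (u # xs)"
  unfolding is_path_def
proof (intro conjI allI impI)
  fix i assume i: "Suc i < length (u # xs)"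
  have ne: "xs \<noteq> []" using assms(1) by (simp add: is_path_def)
  show "{(u # xs) ! i, (u # xs) ! Suc i} \<in> E"
    using i assms(1,4) ne by (cases i) (auto simp: is_path_def hd_conv_nth)
qed (use assms in \<open>auto simp: is_path_def\<close>)

text \<open>The walks that fail to be paths have a repeated vertex, and so one degree of freedom less.\<close>

lemma path_if_many_walks:
  assumes V: "finite V" "v \<in> V"
    and "u \<in> V" "u \<noteq> v" "u \<notin> F" "v \<notin> F" "finite F" "card F \<le> m"
    and "real (k * (m + k + 1)) * real (card V) ^ k < walks V (adj E) (Suc k) u v * real (card V)"
  shows "\<exists>xs. is_path V E xs \<and> length xs = Suc (Suc k) \<and> hd xs = u \<and> last xs = v \<and> set xs \<inter> F = {}"
  using assms(3-)
\<comment> \<open>The path is built from its start. \<open>F\<close> holds the vertices to be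
  avoided, in particular those already used, so \<open>F\<close> and its size bound \<open>m\<close>
  grow by one with each step.\<close>
proof (induction k arbitrary: u F m)
  case 0
  then have "walks V (adj E) (Suc 0) u v > 0"
    by (simp add: zero_less_mult_iff)
  then have "{u, v} \<in> E"
    using walks_1[OF V, of "adj E" u] by (simp split: if_splits)
  then have "is_path V E [u, v]"
    using 0 V by (auto simp: is_path_def less_Suc_eq)
  then show ?case
    using 0 by (intro exI[of _ "[u, v]"]) auto
next
  case (Suc k)
  define n where "n = real (card V)"
  define S where "S = nbrs V (adj E) u"
  define B where "B = F \<union> {u, v}"
  have finS: "finite S" using V by (simp add: S_def)
  have n0: "n \<ge> 0" by (simp add: n_def)
  show ?case
  proof (rule ccontr)
    assume no: "\<not> ?thesis"
    \<comment> \<open>If the bound failed for some \<open>w\<close> outside \<open>B\<close>, the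
      induction hypothesis would give a path from \<open>w\<close> avoiding \<open>F\<close> and
      \<open>u\<close>, and prepending \<open>u\<close> would finish.\<close>
    have good: "walks V (adj E) (Suc k) w v * n \<le> real (k * (m + 1 + k + 1)) * n ^ k"
      if w: "w \<in> S - B" for w
    proof (rule ccontr)
      assume "\<not> ?thesis"
      then have "real (k * (m + 1 + k + 1)) * n ^ k < walks V (adj E) (Suc k) w v * n" by simp
      then have "\<exists>xs. is_path V E xs \<and> length xs = Suc (Suc k) \<and> hd xs = w \<and> last xs = v
          \<and> set xs \<inter> insert u F = {}"
        using w Suc.prems unfolding n_def
        by (intro Suc.IH[of w "insert u F" "m + 1"])
          (auto simp: S_def B_def mem_nbrs card_insert_if simp del: walks.simps)
      then obtain xs where xs: "is_path V E xs" "length xs = Suc (Suc k)" "hd xs = w" "last xs = v"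
          "set xs \<inter> insert u F = {}" by blast
      have "is_path V E (u # xs)"
        using xs w Suc.prems by (intro is_path_Cons) (auto simp: S_def mem_nbrs)
      with xs Suc.prems have "is_path V E (u # xs) \<and> length (u # xs) = Suc (Suc (Suc k)) \<and>
          hd (u # xs) = u \<and> last (u # xs) = v \<and> set (u # xs) \<inter> F = {}"
        by auto
      with no show False by blast
    qed
    \<comment> \<open>The at most \<open>m + 2\<close> vertices of \<open>B\<close> get the trivial
      bound; added to the constant of the induction hypothesis this stays within
      \<open>Suc k * (m + Suc k + 1)\<close>.\<close>
    have bad: "walks V (adj E) (Suc k) w v * n \<le> n ^ Suc k" for w
      using mult_right_mono[OF walks_Suc_le[OF V(1), of "adj E" k w v] n0]
      by (simp add: n_def mult.commute)
    have cB: "card B \<le> m + 2"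
    proof -
      have "card B \<le> card F + card {u, v}" unfolding B_def by (rule card_Un_le)
      also have "card {u, v} \<le> 2" by (simp add: card_insert_if)
      finally show ?thesis using Suc.prems by simp
    qed
    have finB: "finite B" using Suc.prems by (simp add: B_def)
    have "walks V (adj E) (Suc (Suc k)) u v * n = (\<Sum>w\<in>S. walks V (adj E) (Suc k) w v * n)"
      unfolding walks.simps(2)[of V "adj E" "Suc k"] S_def by (rule sum_distrib_right)
    also have "\<dots> = (\<Sum>w\<in>S \<inter> B. walks V (adj E) (Suc k) w v * n)
        + (\<Sum>w\<in>S - B. walks V (adj E) (Suc k) w v * n)"
      by (rule sum.Int_Diff[OF finS])
    also have "\<dots> \<le> real (card (S \<inter> B)) * n ^ Suc k
        + real (card (S - B)) * (real (k * (m + 1 + k + 1)) * n ^ k)"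
      by (intro add_mono sum_bounded_above bad good)
    also have "\<dots> \<le> real (m + 2) * n ^ Suc k + n * (real (k * (m + 1 + k + 1)) * n ^ k)"
    proof (intro add_mono mult_right_mono)
      have "card (S \<inter> B) \<le> card B" using finB by (intro card_mono) auto
      then show "real (card (S \<inter> B)) \<le> real (m + 2)" using cB by linarith
      have "card (S - B) \<le> card V" using V(1) nbrs_subset by (intro card_mono) (auto simp: S_def mem_nbrs)
      then show "real (card (S - B)) \<le> n" by (simp add: n_def)
    qed (use n0 in auto)
    also have "\<dots> = real (m + 2 + k * (m + 1 + k + 1)) * n ^ Suc k"
      by (simp add: algebra_simps)
    also have "\<dots> \<le> real (Suc k * (m + Suc k + 1)) * n ^ Suc k"
      using n0 by (intro mult_right_mono) (simp_all del: of_nat_mult of_nat_add of_nat_Suc)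
    finally show False
      using Suc.prems(7) unfolding n_def[symmetric] by (meson not_le)
  qed
qed

section \<open>Weak regularity\<close>

text \<open>Energy decrement in the style of Frieze and Kannan: while some pair \<open>p\<close>,
  \<open>q\<close> correlates with the remainder, subtracting \<open>e * p a * q b\<close> lowers
  its sum of squares by at least \<open>e\<^sup>2 * (real (card V))\<^sup>2\<close>. The sum of
  squares is at most \<open>(real (card V))\<^sup>2\<close> at the start, which bounds
  \<open>m\<close>.\<close>

lemma weak_regularity:
  fixes A :: "'a \<Rightarrow> 'a \<Rightarrow> real"
  assumes V: "finite V" "V \<noteq> {}" and e: "e > 0"
    and A: "\<And>a b. \<bar>A a b\<bar> \<le> 1"
  shows "\<exists>m f g. real m * e\<^sup>2 \<le> 1 \<and> (\<forall>j a. \<bar>f j a\<bar> \<le> 1 \<and> \<bar>g j a\<bar> \<le> 1) \<and>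
    (\<forall>p q. (\<forall>a. \<bar>p a\<bar> \<le> 1) \<longrightarrow> (\<forall>a. \<bar>q a\<bar> \<le> 1) \<longrightarrow>
      (\<Sum>a\<in>V. \<Sum>b\<in>V. (A a b - (\<Sum>j<m. e * f j a * g j b)) * p a * q b) \<le> e * (real (card V))\<^sup>2)"
proof -
  define n where "n = real (card V)"
  have n: "n > 0" using V by (simp add: n_def card_gt_0_iff)
  define P where "P m \<longleftrightarrow> (\<exists>f g. (\<forall>j a. \<bar>f j a\<bar> \<le> 1 \<and> \<bar>g j a\<bar> \<le> (1::real)) \<and>
      (\<Sum>a\<in>V. \<Sum>b\<in>V. (A a b - (\<Sum>j<m. e * f j a * g j b))\<^sup>2) \<le> n\<^sup>2 * (1 - real m * e\<^sup>2))" for m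
  have le: "real m * e\<^sup>2 \<le> 1" if "P m" for m
  proof -
    from that obtain f g where
      "(\<Sum>a\<in>V. \<Sum>b\<in>V. (A a b - (\<Sum>j<m. e * f j a * g j b))\<^sup>2) \<le> n\<^sup>2 * (1 - real m * e\<^sup>2)"
      unfolding P_def by blast
    moreover have "0 \<le> (\<Sum>a\<in>V. \<Sum>b\<in>V. (A a b - (\<Sum>j<m. e * f j a * g j b))\<^sup>2)"
      by (intro sum_nonneg) auto
    ultimately have "0 \<le> n\<^sup>2 * (1 - real m * e\<^sup>2)" by linarith
    with n show ?thesis by (simp add: zero_le_mult_iff)
  qed
  have bsum: "(\<Sum>a\<in>V. \<Sum>b\<in>V. h a b) \<le> n\<^sup>2" if "\<And>a b. h a b \<le> 1" for h :: "'a \<Rightarrow> 'a \<Rightarrow> real"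
  proof -
    have "(\<Sum>a\<in>V. \<Sum>b\<in>V. h a b) \<le> (\<Sum>a\<in>V. \<Sum>b\<in>V. 1)" using that by (intro sum_mono)
    then show ?thesis by (simp add: n_def power2_eq_square)
  qed
  have "P 0"
    unfolding P_def using A by (intro exI[of _ "\<lambda>_ _. 0"]) (auto intro!: bsum simp: abs_square_le_1)
  moreover have "\<forall>m. P m \<longrightarrow> m \<le> nat \<lceil>1 / e\<^sup>2\<rceil>"
  proof (intro allI impI)
    fix m assume "P m"
    from le[OF this] e have "real m \<le> 1 / e\<^sup>2" by (simp add: field_simps)
    then show "m \<le> nat \<lceil>1 / e\<^sup>2\<rceil>" by linarith
  qed
  \<comment> \<open>With \<open>m\<close> maximal no further subtraction lowers the energy enough,
    so every pair \<open>p\<close>, \<open>q\<close> passes the test.\<close>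
  ultimately obtain m where m: "P m" and max: "\<And>m'. P m' \<Longrightarrow> m' \<le> m"
    using GreatestI_ex_nat[of P] Greatest_le_nat[of P] by metis
  from m obtain f g where fg: "\<And>j a. \<bar>f j a\<bar> \<le> 1" "\<And>j a. \<bar>g j a\<bar> \<le> 1" and
    en: "(\<Sum>a\<in>V. \<Sum>b\<in>V. (A a b - (\<Sum>j<m. e * f j a * g j b))\<^sup>2) \<le> n\<^sup>2 * (1 - real m * e\<^sup>2)"
    unfolding P_def by blast
  have "(\<Sum>a\<in>V. \<Sum>b\<in>V. (A a b - (\<Sum>j<m. e * f j a * g j b)) * p a * q b) \<le> e * n\<^sup>2"
    if p: "\<And>a. \<bar>p a\<bar> \<le> 1" and q: "\<And>a. \<bar>q a\<bar> \<le> 1" for p q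
  proof (rule ccontr)
    define C where "C a b = A a b - (\<Sum>j<m. e * f j a * g j b)" for a b
    assume "\<not> ?thesis"
    then have big: "(\<Sum>a\<in>V. \<Sum>b\<in>V. C a b * p a * q b) > e * n\<^sup>2" by (simp add: C_def)
    \<comment> \<open>The violating pair becomes term number \<open>m\<close>. On expanding the
      square, the cross term removes more than twice what the new square can add.\<close>
    define f' where "f' = f(m := p)"
    define g' where "g' = g(m := q)"
    have "(\<Sum>a\<in>V. \<Sum>b\<in>V. (A a b - (\<Sum>j<Suc m. e * f' j a * g' j b))\<^sup>2)
        = (\<Sum>a\<in>V. \<Sum>b\<in>V. (C a b)\<^sup>2 - 2 * e * (C a b * p a * q b) + e\<^sup>2 * ((p a)\<^sup>2 * (q b)\<^sup>2))"
      by (intro sum.cong refl) (simp add: f'_def g'_def C_def power2_eq_square algebra_simps)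
    also have "\<dots> = (\<Sum>a\<in>V. \<Sum>b\<in>V. (C a b)\<^sup>2) - 2 * e * (\<Sum>a\<in>V. \<Sum>b\<in>V. C a b * p a * q b)
        + e\<^sup>2 * (\<Sum>a\<in>V. \<Sum>b\<in>V. (p a)\<^sup>2 * (q b)\<^sup>2)"
      by (simp add: sum.distrib sum_subtractf sum_distrib_left)
    also have "\<dots> \<le> n\<^sup>2 * (1 - real m * e\<^sup>2) - 2 * e * (e * n\<^sup>2) + e\<^sup>2 * n\<^sup>2"
    proof (intro add_mono diff_mono mult_left_mono)
      show "(\<Sum>a\<in>V. \<Sum>b\<in>V. (C a b)\<^sup>2) \<le> n\<^sup>2 * (1 - real m * e\<^sup>2)" using en by (simp add: C_def)
      show "(\<Sum>a\<in>V. \<Sum>b\<in>V. (p a)\<^sup>2 * (q b)\<^sup>2) \<le> n\<^sup>2"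
        using p q by (intro bsum mult_le_one) (auto simp: abs_square_le_1)
    qed (use big e in auto)
    also have "\<dots> = n\<^sup>2 * (1 - real (Suc m) * e\<^sup>2)" by (simp add: algebra_simps power2_eq_square)
    finally have "P (Suc m)"
      unfolding P_def using fg p q by (intro exI[of _ f'] exI[of _ g']) (auto simp: f'_def g'_def)
    with max show False by fastforce
  qed
  with le[OF m] fg show ?thesis
    unfolding n_def by (intro exI[of _ m] exI[of _ f] exI[of _ g]) auto
qed

text \<open>The codegree function of \<open>x\<close> is the adjacency matrix applied to the row of
  \<open>x\<close>. Up to the regularity error the matrix is a sum of boundedly many products, so
  only the inner products of the \<open>g j\<close> with that row matter, and rounding them leaves
  boundedly many types \<open>t x\<close>.\<close>

lemma codegree_partition:
  fixes \<theta> :: real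
  assumes \<theta>: "\<theta> > 0"
  shows "\<exists>K. \<forall>(V :: 'a set) R. finite V \<longrightarrow> symp R \<longrightarrow> (\<exists>t :: 'a \<Rightarrow> nat \<Rightarrow> int. card (t ` V) \<le> K \<and>
    (\<forall>x\<in>V. \<forall>y\<in>V. t x = t y \<longrightarrow>
      (\<Sum>v\<in>V. \<bar>walks V R 2 x v - walks V R 2 y v\<bar>) \<le> \<theta> * (real (card V))\<^sup>2))"
proof -
  \<comment> \<open>One half of \<open>\<theta>\<close> pays for the regularity error, the other for
    the rounding.\<close>
  define e where "e = \<theta> / 2"
  have e: "e > 0" using \<theta> by (simp add: e_def)
  define M where "M = nat \<lfloor>1 / e\<^sup>2\<rfloor>"
  define L where "L = \<lceil>1 / e\<^sup>2\<rceil>"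
  \<comment> \<open>All possible types. The set does not depend on \<open>V\<close>, so its size
    serves as \<open>K\<close>; the value 0 from \<open>M\<close> on keeps it finite.\<close>
  define T where "T = {h :: nat \<Rightarrow> int. \<forall>j. (j \<in> {..<M} \<longrightarrow> h j \<in> {- L..L}) \<and> (j \<notin> {..<M} \<longrightarrow> h j = 0)}"
  have finT: "finite T" unfolding T_def by (rule finite_set_of_finite_funs) auto
  have "0 \<le> 1 / e\<^sup>2" by simp
  then have L0: "0 \<le> L" unfolding L_def by linarith
  have "\<exists>t :: 'a \<Rightarrow> nat \<Rightarrow> int. card (t ` V) \<le> card T \<and>
    (\<forall>x\<in>V. \<forall>y\<in>V. t x = t y \<longrightarrow>
      (\<Sum>v\<in>V. \<bar>walks V R 2 x v - walks V R 2 y v\<bar>) \<le> \<theta> * (real (card V))\<^sup>2)"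
    if V: "finite V" and R: "symp R" for V :: "'a set" and R
  proof (cases "V = {}")
    case False
    define n where "n = real (card V)"
    have n: "n > 0" using V False by (simp add: n_def card_gt_0_iff)
    define A where "A a b = (of_bool (R a b) :: real)" for a b
    have A01: "0 \<le> A a b" "A a b \<le> 1" for a b by (auto simp: A_def)
    have Asym: "A a b = A b a" for a b using R by (auto simp: A_def dest: sympD)
    have "\<exists>m f g. real m * e\<^sup>2 \<le> 1 \<and> (\<forall>j a. \<bar>f j a\<bar> \<le> 1 \<and> \<bar>g j a\<bar> \<le> 1) \<and>
      (\<forall>p q. (\<forall>a. \<bar>p a\<bar> \<le> 1) \<longrightarrow> (\<forall>a. \<bar>q a\<bar> \<le> 1) \<longrightarrow>
      (\<Sum>a\<in>V. \<Sum>b\<in>V. (A a b - (\<Sum>j<m. e * f j a * g j b)) * p a * q b) \<le> e * (real (card V))\<^sup>2)"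
      using A01 by (intro weak_regularity V False e) (simp add: abs_le_iff order_trans[of _ 0])
    then obtain m f g where m: "real m * e\<^sup>2 \<le> 1"
      and fg: "\<And>j a. \<bar>f j a\<bar> \<le> 1" "\<And>j a. \<bar>g j a\<bar> \<le> (1 :: real)"
      and reg: "\<And>p q. (\<And>a. \<bar>p a\<bar> \<le> 1) \<Longrightarrow> (\<And>a. \<bar>q a\<bar> \<le> 1) \<Longrightarrow>
        (\<Sum>a\<in>V. \<Sum>b\<in>V. (A a b - (\<Sum>j<m. e * f j a * g j b)) * p a * q b) \<le> e * n\<^sup>2"
      unfolding n_def by blast
    have "real m \<le> 1 / e\<^sup>2" using m e by (simp add: field_simps)
    then have mM: "m \<le> M" unfolding M_def by linarith
    \<comment> \<open>Scaled so that equal types have inner products within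
      \<open>e\<^sup>2 * n\<close> of each other; since \<open>m * e\<^sup>2 \<le> 1\<close>, the
      \<open>m\<close> terms together then cost at most \<open>e * n\<^sup>2\<close>.\<close>
    define G where "G j x = (\<Sum>b\<in>V. g j b * A x b) / (e\<^sup>2 * n)" for j x
    define t where "t x j = (if j < m then \<lfloor>G j x\<rfloor> else 0)" for x j
    have Gbd: "\<bar>G j x\<bar> \<le> 1 / e\<^sup>2" for j x
    proof -
      have "\<bar>\<Sum>b\<in>V. g j b * A x b\<bar> \<le> (\<Sum>b\<in>V. \<bar>g j b * A x b\<bar>)" by (rule sum_abs)
      also have "\<dots> \<le> (\<Sum>b\<in>V. 1)"
        using fg A01 by (intro sum_mono) (auto simp: abs_mult intro!: mult_le_one)
      finally have "\<bar>\<Sum>b\<in>V. g j b * A x b\<bar> \<le> n" by (simp add: n_def)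
      then show ?thesis using n e by (simp add: G_def abs_mult field_simps)
    qed
    have "t ` V \<subseteq> T"
    proof -
      have "\<lfloor>G j x\<rfloor> \<in> {- L..L}" for j x
        using Gbd[of j x] unfolding L_def by (simp add: abs_le_iff) linarith
      then show ?thesis using L0 mM by (auto simp: t_def T_def)
    qed
    then have "card (t ` V) \<le> card T" by (rule card_mono[OF finT])
    moreover have "(\<Sum>v\<in>V. \<bar>walks V R 2 x v - walks V R 2 y v\<bar>) \<le> \<theta> * n\<^sup>2"
      if xy: "x \<in> V" "y \<in> V" "t x = t y" for x y
    proof -
      define q where "q b = A x b - A y b" for b
      define D where "D v = walks V R 2 x v - walks V R 2 y v" for v
      \<comment> \<open>The signs turn the \<open>L^1\<close> norm into a bilinear form, to which
        \<open>reg\<close> applies.\<close>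
      define p where "p v = sgn (D v)" for v
      have w2: "walks V R 2 z v = (\<Sum>b\<in>V. A v b * A z b)" if "v \<in> V" for z v
      proof -
        have "walks V R 2 z v = (\<Sum>b\<in>nbrs V R z. walks V R (Suc 0) b v)"
          unfolding numeral_2_eq_2 walks.simps(2)[of V R "Suc 0"] ..
        also have "\<dots> = (\<Sum>b\<in>V. A z b * A b v)"
          by (simp only: sum_nbrs[OF V] A_def walks_1[OF V that])
        finally show ?thesis using Asym[of _ v] by (simp add: mult.commute)
      qed
      have D: "D v = (\<Sum>b\<in>V. A v b * q b)" if "v \<in> V" for v
        by (simp add: D_def w2[OF that] q_def algebra_simps sum_subtractf)
      have p1: "\<bar>p v\<bar> \<le> 1" for v by (simp add: p_def abs_sgn_eq)
      have q1: "\<bar>q v\<bar> \<le> 1" for v by (simp add: q_def A_def)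
      have gq: "\<bar>\<Sum>b\<in>V. g j b * q b\<bar> \<le> e\<^sup>2 * n" if "j < m" for j
      proof -
        have "\<lfloor>G j x\<rfloor> = \<lfloor>G j y\<rfloor>" using fun_cong[OF xy(3), of j] that by (simp add: t_def)
        then have "\<bar>G j x - G j y\<bar> \<le> 1" by linarith
        moreover have "G j x - G j y = (\<Sum>b\<in>V. g j b * q b) / (e\<^sup>2 * n)"
          by (simp add: G_def q_def algebra_simps sum_subtractf diff_divide_distrib)
        ultimately show ?thesis using e n by (simp add: abs_mult field_simps)
      qed
      have "(\<Sum>v\<in>V. \<bar>D v\<bar>) = (\<Sum>v\<in>V. \<Sum>b\<in>V. A v b * p v * q b)"
      proof (intro sum.cong refl)
        fix v assume "v \<in> V"
        have "\<bar>D v\<bar> = p v * D v" by (simp add: p_def abs_sgn mult.commute)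
        also have "\<dots> = (\<Sum>b\<in>V. A v b * p v * q b)"
          unfolding D[OF \<open>v \<in> V\<close>] by (simp add: sum_distrib_left mult_ac)
        finally show "\<bar>D v\<bar> = (\<Sum>b\<in>V. A v b * p v * q b)" .
      qed
      also have "\<dots> = (\<Sum>v\<in>V. \<Sum>b\<in>V. (A v b - (\<Sum>j<m. e * f j v * g j b)) * p v * q b)
          + (\<Sum>v\<in>V. \<Sum>b\<in>V. \<Sum>j<m. e * f j v * g j b * p v * q b)"
        by (simp only: sum.distrib[symmetric] left_diff_distrib sum_distrib_right diff_add_cancel)
      also have "(\<Sum>v\<in>V. \<Sum>b\<in>V. \<Sum>j<m. e * f j v * g j b * p v * q b)
          = (\<Sum>v\<in>V. \<Sum>j<m. e * (f j v * p v) * (\<Sum>b\<in>V. g j b * q b))"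
        by (intro sum.cong refl, subst sum.swap) (simp add: sum_distrib_left mult_ac)
      also have "\<dots> \<le> (\<Sum>v\<in>V. \<Sum>j<m. e * 1 * (e\<^sup>2 * n))"
      proof (intro sum_mono)
        fix v j assume "j \<in> {..<m}"
        then have "\<bar>f j v * p v\<bar> * \<bar>\<Sum>b\<in>V. g j b * q b\<bar> \<le> 1 * (e\<^sup>2 * n)"
          using fg p1 by (intro mult_mono gq) (auto simp: abs_mult intro!: mult_le_one)
        then have "f j v * p v * (\<Sum>b\<in>V. g j b * q b) \<le> 1 * (e\<^sup>2 * n)"
          by (simp add: abs_mult[symmetric])
        then show "e * (f j v * p v) * (\<Sum>b\<in>V. g j b * q b) \<le> e * 1 * (e\<^sup>2 * n)"
          using e by (simp add: mult.assoc)
      qed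
      also have "\<dots> = (real m * e\<^sup>2) * (e * n\<^sup>2)"
        by (simp add: n_def power2_eq_square)
      also have "\<dots> \<le> 1 * (e * n\<^sup>2)"
        using m e by (intro mult_right_mono) auto
      finally show ?thesis
        using reg[of p q, OF p1 q1] by (simp add: D_def e_def)
    qed
    ultimately show ?thesis unfolding n_def by (intro exI[of _ t]) auto
  qed auto
  then show ?thesis by blast
qed

section \<open>Deleting few edges so that many walks give paths\<close>

text \<open>The first two steps from \<open>x\<close> enter only through its codegree function, and
  at most \<open>real (card V) ^ (1 + j)\<close> walks continue from each vertex so reached. This
  bounds the cost of replacing \<open>x\<close> by \<open>x'\<close>, and symmetry handles
  \<open>y\<close>.\<close>

lemma walks_close:
  assumes V: "finite V" "symp R" and mem: "x \<in> V" "y \<in> V" "x' \<in> V" "y' \<in> V"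
    and x: "(\<Sum>v\<in>V. \<bar>walks V R 2 x v - walks V R 2 x' v\<bar>) \<le> d"
    and y: "(\<Sum>v\<in>V. \<bar>walks V R 2 y v - walks V R 2 y' v\<bar>) \<le> d"
  shows "walks V R (4 + j) x y - 2 * d * real (card V) ^ (1 + j) \<le> walks V R (4 + j) x' y'"
proof -
  have one: "walks V R (4 + j) x y - d * real (card V) ^ (1 + j) \<le> walks V R (4 + j) x' y"
    if mem: "x \<in> V" "x' \<in> V"
      and x: "(\<Sum>v\<in>V. \<bar>walks V R 2 x v - walks V R 2 x' v\<bar>) \<le> d" for x x' y
  proof -
    have eq: "4 + j = 2 + Suc (1 + j)" by simp
    have "walks V R (4 + j) x y - walks V R (4 + j) x' y
        = (\<Sum>v\<in>V. (walks V R 2 x v - walks V R 2 x' v) * walks V R (Suc (1 + j)) v y)"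
      unfolding eq walks_add[OF V(1) mem(1)] walks_add[OF V(1) mem(2)]
      by (simp only: sum_subtractf[symmetric] left_diff_distrib)
    also have "\<dots> \<le> (\<Sum>v\<in>V. \<bar>walks V R 2 x v - walks V R 2 x' v\<bar> * real (card V) ^ (1 + j))"
      by (intro sum_mono mult_mono walks_Suc_le[OF V(1)] walks_nonneg) auto
    also have "\<dots> \<le> d * real (card V) ^ (1 + j)"
      unfolding sum_distrib_right[symmetric] using x by (intro mult_right_mono) auto
    finally show ?thesis by simp
  qed
  show ?thesis
    using one[OF mem(1,3) x, of y] one[OF mem(2,4) y, of x'] walks_sym[OF V mem(3,2)]
      walks_sym[OF V mem(3,4)] by (simp del: walks.simps)
qed

text \<open>An edge is deleted when one end has few neighbours in the codegree class of the other.
  If \<open>R u x\<close> and \<open>R y v\<close>, there are linearly many substitutes for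
  \<open>x\<close> next to \<open>u\<close> and for \<open>y\<close> next to \<open>v\<close>, and
  each pair of substitutes still has many walks. So the walks of length \<open>6 + j\<close> from
  \<open>u\<close> to \<open>v\<close> reach the full order \<open>real (card V) ^ (5 + j)\<close>,
  and \<open>path_if_many_walks\<close> applies.\<close>

lemma cleaning:
  fixes \<gamma> c :: real
  assumes \<gamma>: "\<gamma> > 0" and c: "c > 0"
  shows "\<exists>N. \<forall>(V :: 'a set) E. finite V \<longrightarrow> real (card V) \<ge> N \<longrightarrow> (\<exists>R. symp R \<and> (\<forall>u v. R u v \<longrightarrow> adj E u v) \<and>
    (\<Sum>u\<in>V. real (card (nbrs V (adj E) u)) - real (card (nbrs V R u))) \<le> c * (real (card V))\<^sup>2 \<and>
    (\<forall>u\<in>V. \<forall>v\<in>V. \<forall>x\<in>V. \<forall>y\<in>V. u \<noteq> v \<longrightarrow> R u x \<longrightarrow> R y v \<longrightarrow>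
      \<gamma> * real (card V) ^ (3 + j) \<le> walks V R (4 + j) x y \<longrightarrow>
      (\<exists>xs. is_path V E xs \<and> length xs = 7 + j \<and> hd xs = u \<and> last xs = v)))"
proof -
  \<comment> \<open>Replacing both ends costs \<open>2 * \<theta>\<close> in the normalised count,
    half of the assumed \<open>\<gamma>\<close>.\<close>
  define \<theta> where "\<theta> = \<gamma> / 4"
  have \<theta>: "\<theta> > 0" using \<gamma> by (simp add: \<theta>_def)
  obtain K where K: "\<And>(V :: 'a set) R. finite V \<Longrightarrow> symp R \<Longrightarrow> \<exists>t :: 'a \<Rightarrow> nat \<Rightarrow> int. card (t ` V) \<le> K \<and>
    (\<forall>x\<in>V. \<forall>y\<in>V. t x = t y \<longrightarrow>
      (\<Sum>v\<in>V. \<bar>walks V R 2 x v - walks V R 2 y v\<bar>) \<le> \<theta> * (real (card V))\<^sup>2)"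
    using codegree_partition[OF \<theta>, where 'a = 'a] by meson
  \<comment> \<open>Each of at most \<open>K\<close> classes loses fewer than
    \<open>\<kappa> * n\<close> neighbours of a vertex, in total at most \<open>c / 2 * n\<close>;
    the other half of \<open>c\<close> covers deletions caused by the other end. The
    \<open>+ 1\<close> keeps the denominator nonzero.\<close>
  define \<kappa> where "\<kappa> = c / (2 * (real K + 1))"
  have \<kappa>: "\<kappa> > 0" using c by (simp add: \<kappa>_def)
  \<comment> \<open>The constant of \<open>path_if_many_walks\<close> for \<open>k = 5 + j\<close>
    and \<open>m = 0\<close>; \<open>N\<close> makes the main term exceed it.\<close>
  define q where "q = real ((5 + j) * (0 + (5 + j) + 1))"
  define N where "N = q / (\<kappa>\<^sup>2 * (\<gamma> / 2)) + 1"
  show ?thesis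
  proof (intro exI[of _ N] allI impI)
    fix V :: "'a set" and E :: "'a set set" assume V: "finite V" and N: "N \<le> real (card V)"
    define n where "n = real (card V)"
    define A where "A = adj E"
    have A: "symp A" by (auto simp: A_def symp_def insert_commute)
    have "0 \<le> q / (\<kappa>\<^sup>2 * (\<gamma> / 2))" using \<gamma> unfolding q_def by (intro divide_nonneg_nonneg) auto
    then have "N > 0" unfolding N_def by linarith
    then have n0: "n > 0" using N by (simp add: n_def)
    obtain t :: "'a \<Rightarrow> nat \<Rightarrow> int" where tK: "card (t ` V) \<le> K" and t: "\<And>x y. x \<in> V \<Longrightarrow> y \<in> V \<Longrightarrow> t x = t y \<Longrightarrow>
      (\<Sum>v\<in>V. \<bar>walks V A 2 x v - walks V A 2 y v\<bar>) \<le> \<theta> * n\<^sup>2"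
      using K[OF V A] unfolding n_def by blast
    define X where "X u x = {x' \<in> nbrs V A u. t x' = t x}" for u x
    define big where "big u x \<longleftrightarrow> \<kappa> * n \<le> real (card (X u x))" for u x
    define R where "R u x \<longleftrightarrow> A u x \<and> big u x \<and> big x u" for u x
    have R: "symp R" using A by (auto simp: R_def symp_def)
    define B where "B u = {x \<in> nbrs V A u. \<not> big u x}" for u
    have cardB: "real (card (B u)) \<le> c / 2 * n" for u
    proof -
      have finB: "finite (B u)" using V by (simp add: B_def)
      have "card (B u) = card (\<Union>\<tau>\<in>t ` B u. {x \<in> B u. t x = \<tau>})"
        by (rule arg_cong[of _ _ card]) blast
      also have "\<dots> \<le> (\<Sum>\<tau>\<in>t ` B u. card {x \<in> B u. t x = \<tau>})"
        using finB by (intro card_UN_le) simp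
      finally have "real (card (B u)) \<le> (\<Sum>\<tau>\<in>t ` B u. real (card {x \<in> B u. t x = \<tau>}))"
        unfolding of_nat_sum[symmetric] of_nat_le_iff .
      also have "\<dots> \<le> (\<Sum>\<tau>\<in>t ` B u. \<kappa> * n)"
      proof (intro sum_mono)
        fix \<tau> assume "\<tau> \<in> t ` B u"
        then obtain x where x: "x \<in> B u" "\<tau> = t x" by blast
        have "card {x \<in> B u. t x = \<tau>} \<le> card (X u x)"
          using V x by (intro card_mono) (auto simp: X_def B_def)
        moreover have "real (card (X u x)) < \<kappa> * n"
          using x(1) by (simp add: B_def big_def)
        ultimately show "real (card {x \<in> B u. t x = \<tau>}) \<le> \<kappa> * n" by linarith
      qed
      also have "\<dots> \<le> (real K + 1) * (\<kappa> * n)"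
      proof -
        have "card (t ` B u) \<le> card (t ` V)"
          using V by (intro card_mono) (auto simp: B_def mem_nbrs)
        then have "real (card (t ` B u)) \<le> real K + 1" using tK by linarith
        then have "real (card (t ` B u)) * (\<kappa> * n) \<le> (real K + 1) * (\<kappa> * n)"
          using \<kappa> n0 by (intro mult_right_mono) auto
        then show ?thesis by (simp only: sum_constant)
      qed
      also have "\<dots> = c / 2 * n"
      proof -
        have "real K + 1 \<noteq> 0" by linarith
        then show ?thesis unfolding \<kappa>_def by (simp add: divide_simps)
      qed
      finally show ?thesis .
    qed
    have "(\<Sum>u\<in>V. real (card (nbrs V A u)) - real (card (nbrs V R u))) \<le>
      (\<Sum>u\<in>V. \<Sum>x\<in>V. of_bool (A u x \<and> \<not> big u x) + of_bool (A x u \<and> \<not> big x u))"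
      unfolding card_nbrs_sum[OF V] sum_subtractf[symmetric]
    proof (intro sum_mono)
      fix u x
      have "A x u = A u x" using A by (auto dest: sympD)
      then show "of_bool (A u x) - of_bool (R u x)
          \<le> (of_bool (A u x \<and> \<not> big u x) + of_bool (A x u \<and> \<not> big x u) :: real)"
        by (simp add: R_def)
    qed
    also have "\<dots> = 2 * (\<Sum>u\<in>V. \<Sum>x\<in>V. of_bool (A u x \<and> \<not> big u x))"
      unfolding sum.distrib
      using sum.swap[of "\<lambda>u x. of_bool (A x u \<and> \<not> big x u) :: real" V V] by simp
    also have "(\<Sum>u\<in>V. \<Sum>x\<in>V. of_bool (A u x \<and> \<not> big u x)) = (\<Sum>u\<in>V. real (card (B u)))"
    proof (intro sum.cong refl)
      fix u
      have "B u = nbrs V (\<lambda>u x. A u x \<and> \<not> big u x) u" by (auto simp: B_def nbrs_def)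
      then show "(\<Sum>x\<in>V. of_bool (A u x \<and> \<not> big u x)) = real (card (B u))"
        using card_nbrs_sum[OF V, of "\<lambda>u x. A u x \<and> \<not> big u x" u] by simp
    qed
    also have "2 * (\<Sum>u\<in>V. real (card (B u))) \<le> 2 * (\<Sum>u\<in>V. c / 2 * n)"
      by (intro mult_left_mono sum_mono cardB) simp
    also have "\<dots> = c * n\<^sup>2" by (simp add: n_def power2_eq_square)
    finally have del: "(\<Sum>u\<in>V. real (card (nbrs V A u)) - real (card (nbrs V R u))) \<le> c * n\<^sup>2" .
    have path: "\<exists>xs. is_path V E xs \<and> length xs = 7 + j \<and> hd xs = u \<and> last xs = v"
      if mem: "u \<in> V" "v \<in> V" "x \<in> V" "y \<in> V" "u \<noteq> v" and ux: "R u x" and yv: "R y v"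
        and w: "\<gamma> * n ^ (3 + j) \<le> walks V R (4 + j) x y" for u v x y
    proof -
      \<comment> \<open>The classes refer to codegrees in \<open>A\<close>, so the walks are first
        counted in the larger graph \<open>A\<close> and only then moved to \<open>x'\<close> and
        \<open>y'\<close>.\<close>
      have w': "\<gamma> / 2 * n ^ (3 + j) \<le> walks V A (4 + j) x' y'" if x': "x' \<in> X u x" and y': "y' \<in> X v y" for x' y'
      proof -
        have xy': "x' \<in> V" "y' \<in> V" "t x = t x'" "t y = t y'" using x' y' by (auto simp: X_def mem_nbrs)
        have "\<gamma> * n ^ (3 + j) \<le> walks V A (4 + j) x y"
          using w walks_mono[OF V, of R A "4 + j" x y] unfolding R_def by linarith
        moreover have "walks V A (4 + j) x y - 2 * (\<theta> * n\<^sup>2) * n ^ (1 + j) \<le> walks V A (4 + j) x' y'"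
          unfolding n_def using mem xy' t
          by (intro walks_close V A) (auto simp: n_def)
        moreover have "2 * (\<theta> * n\<^sup>2) * n ^ (1 + j) = \<gamma> / 2 * n ^ (3 + j)"
          by (simp add: \<theta>_def power_add power2_eq_square power3_eq_cube)
        ultimately show ?thesis by (simp add: field_simps)
      qed
      have Xu: "\<kappa> * n \<le> real (card (X u x))" and Xv: "\<kappa> * n \<le> real (card (X v y))"
        using ux yv by (auto simp: R_def big_def)
      have "\<kappa>\<^sup>2 * (\<gamma> / 2) * n ^ (5 + j) = (\<kappa> * n) * ((\<kappa> * n) * (\<gamma> / 2 * n ^ (3 + j)))"
        by (simp add: power_add power2_eq_square eval_nat_numeral)
      also have "\<dots> \<le> real (card (X u x)) * (real (card (X v y)) * (\<gamma> / 2 * n ^ (3 + j)))"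
        using Xu Xv \<kappa> n0 \<gamma> by (intro mult_mono) auto
      also have "\<dots> = (\<Sum>x'\<in>X u x. \<Sum>y'\<in>X v y. \<gamma> / 2 * n ^ (3 + j))" by simp
      also have "\<dots> \<le> (\<Sum>x'\<in>X u x. \<Sum>y'\<in>X v y. walks V A (4 + j) x' y')"
        by (intro sum_mono w')
      also have "\<dots> \<le> (\<Sum>x'\<in>X u x. \<Sum>y'\<in>nbrs V A v. walks V A (4 + j) x' y')"
        using V by (intro sum_mono sum_mono2) (auto simp: X_def intro!: walks_nonneg)
      also have "\<dots> \<le> (\<Sum>x'\<in>nbrs V A u. \<Sum>y'\<in>nbrs V A v. walks V A (4 + j) x' y')"
        using V by (intro sum_mono2) (auto simp: X_def intro!: sum_nonneg walks_nonneg)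
      also have "\<dots> = (\<Sum>x'\<in>nbrs V A u. walks V A (Suc (4 + j)) x' v)"
      proof (intro sum.cong refl)
        fix x' assume x': "x' \<in> nbrs V A u"
        have "walks V A (Suc (4 + j)) x' v = walks V A (Suc (4 + j)) v x'"
          using x' mem walks_sym[OF V A] by (auto simp: mem_nbrs simp del: walks.simps)
        also have "\<dots> = (\<Sum>y'\<in>nbrs V A v. walks V A (4 + j) y' x')" by (rule walks.simps(2))
        also have "\<dots> = (\<Sum>y'\<in>nbrs V A v. walks V A (4 + j) x' y')"
          using x' walks_sym[OF V A] by (intro sum.cong) (auto simp: mem_nbrs simp del: walks.simps)
        finally show "(\<Sum>y'\<in>nbrs V A v. walks V A (4 + j) x' y') = walks V A (Suc (4 + j)) x' v" ..
      qed
      also have "\<dots> = walks V A (Suc (5 + j)) u v"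
        unfolding walks.simps(2)[of V A "5 + j"] by (simp only: numeral_eq_Suc pred_numeral_simps add_Suc arith_simps)
      finally have big: "\<kappa>\<^sup>2 * (\<gamma> / 2) * n ^ (5 + j) \<le> walks V A (Suc (5 + j)) u v" .
      have "q < \<kappa>\<^sup>2 * (\<gamma> / 2) * n"
      proof -
        have "q / (\<kappa>\<^sup>2 * (\<gamma> / 2)) < n" using N by (simp add: N_def n_def)
        then show ?thesis using \<kappa> \<gamma> by (simp add: field_simps)
      qed
      then have "q * n ^ (5 + j) < \<kappa>\<^sup>2 * (\<gamma> / 2) * n * n ^ (5 + j)"
        using n0 by (intro mult_strict_right_mono) auto
      also have "\<dots> = \<kappa>\<^sup>2 * (\<gamma> / 2) * n ^ (5 + j) * n" by simp
      also have "\<dots> \<le> walks V A (Suc (5 + j)) u v * n"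
        using big n0 by (intro mult_right_mono) auto
      finally have "\<exists>xs. is_path V E xs \<and> length xs = Suc (Suc (5 + j)) \<and> hd xs = u \<and> last xs = v \<and> set xs \<inter> {} = {}"
        unfolding q_def A_def n_def using V mem by (intro path_if_many_walks[where m = 0]) auto
      then show ?thesis by auto
    qed
    show "\<exists>R. symp R \<and> (\<forall>u v. R u v \<longrightarrow> adj E u v) \<and>
      (\<Sum>u\<in>V. real (card (nbrs V (adj E) u)) - real (card (nbrs V R u))) \<le> c * (real (card V))\<^sup>2 \<and>
      (\<forall>u\<in>V. \<forall>v\<in>V. \<forall>x\<in>V. \<forall>y\<in>V. u \<noteq> v \<longrightarrow> R u x \<longrightarrow> R y v \<longrightarrow>
        \<gamma> * real (card V) ^ (3 + j) \<le> walks V R (4 + j) x y \<longrightarrow>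
        (\<exists>xs. is_path V E xs \<and> length xs = 7 + j \<and> hd xs = u \<and> last xs = v))"
      unfolding n_def[symmetric]
    proof (intro exI[of _ R] conjI ballI impI allI)
      show "{u, v} \<in> E" if "R u v" for u v using that by (simp add: R_def A_def)
    qed (fact R, fact del[unfolded A_def], fact path)
  qed
qed

section \<open>Degree sums\<close>

text \<open>Deleting a vertex of degree less than \<open>D\<close> removes less than
  \<open>2 * D\<close> from the degree sum, so the strict inequality persists and the process stops
  before the set is empty.\<close>

lemma min_degree_subset:
  fixes D :: real
  assumes "finite W" "symp R" "D \<ge> 0"
    and "2 * D * real (card W) < (\<Sum>w\<in>W. real (card (nbrs W R w)))"
  shows "\<exists>U\<subseteq>W. U \<noteq> {} \<and> (\<forall>u\<in>U. D \<le> real (card (nbrs U R u)))"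
  using assms(1,4)
proof (induction "card W" arbitrary: W rule: less_induct)
  case less
  show ?case
  proof (cases "\<forall>u\<in>W. D \<le> real (card (nbrs W R u))")
    case True
    then show ?thesis using less.prems(2) by (intro exI[of _ W]) auto
  next
    case False
    then obtain v where v: "v \<in> W" "real (card (nbrs W R v)) < D" by auto
    let ?W = "W - {v}"
    have split: "real (card (nbrs W R w)) = real (card (nbrs ?W R w)) + of_bool (R w v)" for w
      using less.prems(1) unfolding card_nbrs_sum[OF less.prems(1)] sum.remove[OF less.prems(1) v(1)]
      by (subst card_nbrs_sum) simp_all
    have "(\<Sum>w\<in>?W. of_bool (R w v) :: real) \<le> real (card (nbrs W R v))"
      unfolding card_nbrs_sum[OF less.prems(1)]
      using less.prems(1) sympD[OF assms(2)] by (intro order_trans[OF sum_mono sum_mono2]) auto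
    then have "(\<Sum>w\<in>W. real (card (nbrs W R w))) \<le> (\<Sum>w\<in>?W. real (card (nbrs ?W R w))) + 2 * D"
      using v(2) unfolding sum.remove[OF less.prems(1) v(1)]
      by (simp add: split sum.distrib)
    moreover have "real (card W) = real (card ?W) + 1"
      using card_Suc_Diff1[OF less.prems(1) v(1)] by linarith
    ultimately have "2 * D * real (card ?W) < (\<Sum>w\<in>?W. real (card (nbrs ?W R w)))"
      using less.prems(2) by (simp add: algebra_simps)
    moreover have "card ?W < card W"
      using less.prems(1) v(1) by (rule card_Diff1_less)
    ultimately have "\<exists>U\<subseteq>?W. U \<noteq> {} \<and> (\<forall>u\<in>U. D \<le> real (card (nbrs U R u)))"
      using less.prems(1) by (intro less.hyps) auto
    then show ?thesis by blast
  qed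
qed

lemma walks_min_degree:
  fixes D :: real
  assumes "finite V" "U \<subseteq> V" "D \<ge> 0" "\<And>u. u \<in> U \<Longrightarrow> D \<le> real (card (nbrs U R u))" "u \<in> U"
  shows "D ^ k \<le> (\<Sum>v\<in>U. walks V R k u v)"
  using assms(5)
proof (induction k arbitrary: u)
  case 0
  have "finite U" using assms(1,2) by (rule finite_subset[rotated])
  then show ?case using 0 by (simp add: of_bool_def)
next
  case (Suc k)
  have fin: "finite U" using assms(1,2) by (rule finite_subset[rotated])
  have "D ^ Suc k \<le> real (card (nbrs U R u)) * D ^ k"
    using assms(3,4) Suc.prems by (simp add: mult_right_mono)
  also have "\<dots> = (\<Sum>w\<in>nbrs U R u. D ^ k)" by simp
  also have "\<dots> \<le> (\<Sum>w\<in>nbrs U R u. \<Sum>v\<in>U. walks V R k w v)"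
    by (intro sum_mono Suc.IH) (simp add: mem_nbrs)
  also have "\<dots> \<le> (\<Sum>w\<in>nbrs V R u. \<Sum>v\<in>U. walks V R k w v)"
    using assms(1,2) by (intro sum_mono2 sum_nonneg walks_nonneg) (auto simp: mem_nbrs)
  also have "\<dots> = (\<Sum>v\<in>U. walks V R (Suc k) u v)"
    by (simp add: sum.swap[of _ U])
  finally show ?case .
qed

text \<open>Go from \<open>x\<close> in two steps to some \<open>a\<close> in a subset
  \<open>U\<close> of minimum degree \<open>D\<close>, in at least \<open>h\<close> ways; walk
  \<open>j\<close> steps inside \<open>U\<close>; return in two steps, again in at least
  \<open>h\<close> ways. Since \<open>U\<close> has at least \<open>D\<close> vertices, the choice
  of \<open>a\<close> supplies one more factor \<open>D\<close>.\<close>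

lemma closed_walks_ge:
  fixes \<eta> D :: real
  assumes V: "finite V" "symp R" "x \<in> V"
    and W: "W \<subseteq> V" "\<And>w. w \<in> W \<Longrightarrow> h \<le> walks V R 2 x w"
    and nonneg: "0 \<le> D" "0 \<le> h"
    and many: "2 * D * real (card W) < (\<Sum>w\<in>W. real (card (nbrs W R w)))"
  shows "h\<^sup>2 * D ^ Suc j \<le> walks V R (4 + j) x x"
proof -
  have finW: "finite W" using V(1) W(1) by (rule finite_subset[rotated])
  obtain U where U: "U \<subseteq> W" "U \<noteq> {}" "\<And>u. u \<in> U \<Longrightarrow> D \<le> real (card (nbrs U R u))"
    using min_degree_subset[OF finW V(2) nonneg(1) many] by auto
  have UV: "U \<subseteq> V" using U(1) W(1) by (rule subset_trans)
  have finU: "finite U" using U(1) finW by (rule finite_subset)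
  obtain u where "u \<in> U" using U(2) by auto
  then have cU: "D \<le> real (card U)"
    using U(3)[of u] card_nbrs_le[OF finU, of R u] by linarith
  have "h\<^sup>2 * D ^ Suc j \<le> h\<^sup>2 * (real (card U) * D ^ j)"
    using cU nonneg by (simp add: mult_left_mono mult_right_mono)
  also have "\<dots> = h\<^sup>2 * (\<Sum>a\<in>U. D ^ j)" by simp
  also have "\<dots> \<le> h\<^sup>2 * (\<Sum>a\<in>U. \<Sum>b\<in>U. walks V R j a b)"
    using V(1) UV nonneg(1) U(3) by (intro mult_left_mono sum_mono walks_min_degree) auto
  also have "\<dots> = (\<Sum>a\<in>U. \<Sum>b\<in>U. h * (walks V R j a b * h))"
    by (simp add: sum_distrib_left power2_eq_square mult_ac)
  also have "\<dots> \<le> (\<Sum>a\<in>U. \<Sum>b\<in>U. walks V R 2 x a * (walks V R j a b * walks V R 2 b x))"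
  proof (intro sum_mono mult_mono W(2))
    fix b assume "b \<in> U"
    then show "h \<le> walks V R 2 b x"
      using U(1) W UV walks_sym[OF V(1,2), of b x 2] V(3) by (metis subsetD)
  qed (use U(1) nonneg in \<open>auto intro: walks_nonneg mult_nonneg_nonneg\<close>)
  also have "\<dots> \<le> (\<Sum>a\<in>U. \<Sum>b\<in>V. walks V R 2 x a * (walks V R j a b * walks V R 2 b x))"
    using V(1) UV by (intro sum_mono sum_mono2) (auto intro!: walks_nonneg mult_nonneg_nonneg)
  also have "\<dots> \<le> (\<Sum>a\<in>V. \<Sum>b\<in>V. walks V R 2 x a * (walks V R j a b * walks V R 2 b x))"
    using V(1) UV by (intro sum_mono2) (auto intro!: walks_nonneg mult_nonneg_nonneg sum_nonneg)
  also have "\<dots> = (\<Sum>a\<in>V. walks V R 2 x a * walks V R (j + 2) a x)"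
    by (intro sum.cong refl) (simp only: walks_add[OF V(1)] sum_distrib_left)
  also have "\<dots> = walks V R (2 + (j + 2)) x x"
    by (rule walks_add[OF V(1,3), symmetric])
  also have "2 + (j + 2) = 4 + j" by simp
  finally show ?thesis .
qed

section \<open>Bounds on the degree sum\<close>

text \<open>Once the largest value is removed, the bound on the other distinct integers drops by
  one, so in decreasing order the values are at most \<open>L\<close>, \<open>L - 1\<close>,
  \<open>L - 2\<close> and so on.\<close>

lemma sum_distinct_le:
  assumes "finite S" "inj_on f S" "\<And>s. s \<in> S \<Longrightarrow> real (f s) \<le> L"
  shows "(\<Sum>s\<in>S. real (f s)) \<le> real (card S) * L - real (card S) * (real (card S) - 1) / 2"
  using assms
proof (induction "card S" arbitrary: S L)
  case (Suc k)
  have ne: "S \<noteq> {}" using Suc.hyps(2) by auto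
  have "Max (f ` S) \<in> f ` S" using Suc.prems(1) ne by (intro Max_in) auto
  then obtain s where s1: "s \<in> S" "f s = Max (f ` S)" by auto
  have s: "s \<in> S" "\<And>r. r \<in> S \<Longrightarrow> f r \<le> f s"
    using s1 Suc.prems(1) by auto
  let ?S = "S - {s}"
  have k: "k = card ?S" using Suc.hyps(2) Suc.prems(1) s(1) by simp
  have lt: "real (f r) \<le> L - 1" if r: "r \<in> ?S" for r
  proof -
    have "f r \<noteq> f s" using r s(1) Suc.prems(2) by (auto dest: inj_onD)
    then have "f r < f s" using s(2)[of r] r by auto
    then show ?thesis using Suc.prems(3)[OF s(1)] by linarith
  qed
  have "(\<Sum>r\<in>?S. real (f r)) \<le> real (card ?S) * (L - 1) - real (card ?S) * (real (card ?S) - 1) / 2"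
    using Suc.prems lt by (intro Suc.hyps(1)[OF k]) (auto intro: inj_on_subset)
  moreover have "(\<Sum>r\<in>S. real (f r)) = real (f s) + (\<Sum>r\<in>?S. real (f r))"
    using Suc.prems(1) s(1) by (rule sum.remove)
  moreover have "real (f s) \<le> L" using Suc.prems(3) s(1) .
  moreover have "real (card S) = real k + 1" using Suc.hyps(2) by linarith
  ultimately show ?case unfolding k[symmetric] by (simp add: field_simps)
qed simp

text \<open>With \<open>M\<close> the maximum degree, the neighbours of \<open>x\<close> contribute about \<open>M\<^sup>2 / 2\<close> and the other
  vertices at most \<open>(n - M) M\<close>, and \<open>M\<^sup>2 / 2 + (n - M) M \<le> n\<^sup>2 / 2\<close>.\<close>

lemma degree_sum_le_if_distinct:
  fixes V C :: "'a set" and f d :: "'a \<Rightarrow> nat" and \<beta> :: real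
  defines "n \<equiv> real (card V)"
  assumes V: "finite V" "C \<subseteq> V" and \<beta>: "\<beta> > 0" "1 \<le> \<beta> * n"
    and df: "\<And>v. v \<in> V \<Longrightarrow> d v \<le> f v"
    and dmax: "\<And>v. v \<in> V \<Longrightarrow> d v \<le> card C"
    and inj: "inj_on f C"
    and del: "(\<Sum>v\<in>V. real (f v) - real (d v)) \<le> \<beta>\<^sup>2 * n\<^sup>2"
  shows "(\<Sum>v\<in>V. real (d v)) \<le> (1 / 2 + 3 * \<beta>) * n\<^sup>2"
proof -
  define M where "M = real (card C)"
  \<comment> \<open>Distinctness concerns \<open>f\<close>, but the bound \<open>M\<close> concerns
    \<open>d\<close>. On \<open>B\<close> the two differ by more than \<open>\<beta> * n\<close>, so
    \<open>del\<close> makes \<open>B\<close> small; off \<open>B\<close> the distinct values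
    \<open>f v\<close> are at most \<open>M + \<beta> * n\<close>.\<close>
  define B where "B = {v \<in> V. real (f v) > M + \<beta> * n}"
  define S where "S = C - B"
  define m where "m = real (card S)"
  have n: "n > 0" using \<beta> by (metis mult_zero_right n_def not_one_le_zero of_nat_0_le_iff order_le_less)
  have finC: "finite C" using V by (rule finite_subset[rotated])
  have "real (card B) * (\<beta> * n) = (\<Sum>v\<in>B. \<beta> * n)" by simp
  also have "\<dots> \<le> (\<Sum>v\<in>B. real (f v) - real (d v))"
    using dmax by (intro sum_mono) (force simp: B_def M_def)
  also have "\<dots> \<le> (\<Sum>v\<in>V. real (f v) - real (d v))"
    using V df by (intro sum_mono2) (auto simp: B_def)
  also have "\<dots> \<le> (\<beta> * n) * (\<beta> * n)" using del by (simp add: power2_eq_square mult_ac)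
  finally have B: "real (card B) \<le> \<beta> * n" using \<beta> n by simp
  have mM: "m \<le> M" using finC by (simp add: m_def M_def S_def card_mono)
  have "card C \<le> card S + card B"
  proof -
    have "card C \<le> card (S \<union> B)"
      using finC V by (intro card_mono) (auto simp: S_def B_def)
    then show ?thesis using card_Un_le[of S B] by linarith
  qed
  then have Mm: "M - \<beta> * n \<le> m" using B by (simp add: M_def m_def)
  have Mn: "M \<le> n" using V by (simp add: M_def n_def card_mono)
  have "(\<Sum>v\<in>S. real (d v)) \<le> (\<Sum>v\<in>S. real (f v))"
    using df V by (intro sum_mono) (auto simp: S_def)
  also have "\<dots> \<le> m * (M + \<beta> * n) - m * (m - 1) / 2"
    unfolding m_def using finC inj V
    by (intro sum_distinct_le) (auto simp: S_def B_def intro: inj_on_subset)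
  finally have 1: "(\<Sum>v\<in>S. real (d v)) \<le> m * (M + \<beta> * n) - m * (m - 1) / 2" .
  have SV: "S \<subseteq> V" using V by (auto simp: S_def)
  have cVS: "real (card (V - S)) = n - m"
    using SV V(1) by (simp add: card_Diff_subset finite_subset n_def m_def of_nat_diff card_mono)
  have "(\<Sum>v\<in>V - S. real (d v)) \<le> (\<Sum>v\<in>V - S. M)"
    using dmax by (intro sum_mono) (auto simp: M_def)
  then have 2: "(\<Sum>v\<in>V - S. real (d v)) \<le> (n - m) * M" using cVS by simp
  have "(\<Sum>v\<in>V. real (d v)) = (\<Sum>v\<in>V - S. real (d v)) + (\<Sum>v\<in>S. real (d v))"
    using SV V(1) by (rule sum.subset_diff)
  also have "\<dots> \<le> n * M + m * (\<beta> * n) + m / 2 - m\<^sup>2 / 2"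
    using 1 2 by (simp add: algebra_simps power2_eq_square diff_divide_distrib)
  also have "\<dots> \<le> n * M + n * (\<beta> * n) + n * (\<beta> * n) / 2 - (M\<^sup>2 - 2 * (\<beta> * n) * n) / 2"
  proof -
    have i: "m * (\<beta> * n) \<le> n * (\<beta> * n)" using mM Mn \<beta> n by (intro mult_right_mono) auto
    have ii: "m \<le> n * (\<beta> * n)"
      using mult_left_mono[OF \<beta>(2), of n] mM Mn n by linarith
    \<comment> \<open>This squares \<open>M - \<beta> * n \<le> m\<close>, which needs a nonnegative
      left side; otherwise \<open>M * M\<close> is itself at most
      \<open>\<beta> * n * n\<close>.\<close>
    have iii: "M\<^sup>2 - 2 * (\<beta> * n) * n \<le> m\<^sup>2"
    proof (cases "\<beta> * n \<le> M")
      case True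
      then have "(M - \<beta> * n)\<^sup>2 \<le> m\<^sup>2" using Mm by (intro power_mono) auto
      moreover have "M\<^sup>2 - 2 * (\<beta> * n) * M \<le> (M - \<beta> * n)\<^sup>2"
        unfolding power2_diff using zero_le_power2[of "\<beta> * n"] by (simp only: mult_ac)
      moreover have "(\<beta> * n) * M \<le> (\<beta> * n) * n" using Mn \<beta> n by (intro mult_left_mono) auto
      ultimately show ?thesis by linarith
    next
      case False
      have "M * M \<le> (\<beta> * n) * n" using False Mn by (intro mult_mono) (auto simp: M_def)
      moreover have "0 \<le> (\<beta> * n) * n" using \<beta>(1) n by (intro mult_nonneg_nonneg) auto
      moreover have "0 \<le> m\<^sup>2" by simp
      ultimately show ?thesis unfolding power2_eq_square[of M] mult.assoc by linarith
    qed
    show ?thesis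
      using i ii iii by (intro diff_mono add_mono divide_right_mono order_refl) auto
  qed
  also have "\<dots> \<le> (1 / 2 + 3 * \<beta>) * n\<^sup>2"
  proof -
    \<comment> \<open>This gives \<open>n * M - M\<^sup>2 / 2 \<le> n\<^sup>2 / 2\<close>; the error
      terms add up to \<open>5 / 2 * \<beta> * n\<^sup>2\<close>.\<close>
    have "0 \<le> (n - M)\<^sup>2" by simp
    moreover have "0 \<le> \<beta> * n\<^sup>2" using \<beta> by simp
    ultimately show ?thesis by (simp add: power2_eq_square algebra_simps diff_divide_distrib)
  qed
  finally show ?thesis .
qed

text \<open>Mantel's argument: since \<open>x\<close> has maximum degree, both ends of an edge \<open>uv\<close> with
  \<open>d(u) + d(v) > (1 + \<eta>) n\<close> lie in \<open>W\<close>.\<close>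

lemma degree_sum_le_if_sparse:
  fixes V :: "'a set" and \<mu> :: real and d :: "'a \<Rightarrow> real"
  defines "n \<equiv> real (card V)"
  assumes V: "finite V" "symp R" and \<mu>: "\<mu> > 0"
    and d: "\<And>v. d v = real (card (nbrs V R v))"
    and dmax: "\<And>v. v \<in> V \<Longrightarrow> d v \<le> d x"
    and W: "W = {w \<in> V. \<mu> / 4 * n \<le> real (card (nbrs V R w \<inter> nbrs V R x))}"
    and sparse: "(\<Sum>w\<in>W. real (card (nbrs W R w))) \<le> \<mu> / 4 * n\<^sup>2"
  shows "(\<Sum>v\<in>V. d v) \<le> (1 / 2 + \<mu>) * n\<^sup>2"
proof (cases "V = {}")
  case False
  have n: "n > 0" using V False by (simp add: n_def card_gt_0_iff)
  define S where "S = (\<Sum>v\<in>V. d v)"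
  have dn: "d v \<le> n" for v using card_nbrs_le[OF V(1)] by (simp add: d n_def)
  have d0: "0 \<le> d v" for v by (simp add: d)
  have WV: "W \<subseteq> V" by (auto simp: W)
  have inW: "u \<in> W" if u: "u \<in> V" "n * (1 + \<mu> / 4) < d u + d v" "v \<in> V" for u v
  proof -
    have "card (nbrs V R u) + card (nbrs V R x)
        = card (nbrs V R u \<union> nbrs V R x) + card (nbrs V R u \<inter> nbrs V R x)"
      using V by (intro card_Un_Int) auto
    moreover have "card (nbrs V R u \<union> nbrs V R x) \<le> card V"
      using V by (intro card_mono) (auto simp: mem_nbrs)
    ultimately have "d u + d x - n \<le> real (card (nbrs V R u \<inter> nbrs V R x))"
      by (simp add: d n_def)
    with u dmax[of v] show ?thesis by (simp add: W algebra_simps)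
  qed
  have deg: "d v = (\<Sum>u\<in>V. of_bool (R v u))" for v
    using card_nbrs_sum[OF V(1)] d by simp
  \<comment> \<open>An edge with a large degree sum has both ends in \<open>W\<close> and is charged
    the trivial bound \<open>2 * n\<close>; every other edge satisfies Mantel's inequality up to the
    factor \<open>1 + \<mu> / 4\<close>.\<close>
  have edge: "of_bool (R u v) * (d u + d v)
      \<le> of_bool (R u v) * (n * (1 + \<mu> / 4)) + of_bool (u \<in> W \<and> v \<in> W \<and> R u v) * (2 * n)"
    if "u \<in> V" "v \<in> V" for u v
    using inW[of u v] inW[of v u] dn[of u] dn[of v] n \<mu> that
    by (cases "n * (1 + \<mu> / 4) < d u + d v") (auto simp: algebra_simps add_increasing2)
  \<comment> \<open>Over ordered adjacent pairs, each vertex \<open>u\<close> contributes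
    \<open>d u\<close> exactly \<open>d u\<close> times from either side.\<close>
  have "(\<Sum>u\<in>V. \<Sum>v\<in>V. of_bool (R u v) * (d u + d v))
      = (\<Sum>u\<in>V. \<Sum>v\<in>V. of_bool (R u v) * d u) + (\<Sum>u\<in>V. \<Sum>v\<in>V. of_bool (R u v) * d v)"
    by (simp add: sum.distrib distrib_left)
  also have "(\<Sum>u\<in>V. \<Sum>v\<in>V. of_bool (R u v) * d v) = (\<Sum>u\<in>V. \<Sum>v\<in>V. of_bool (R u v) * d u)"
    by (subst sum.swap) (use V(2) in \<open>auto intro!: sum.cong dest: sympD\<close>)
  also have "(\<Sum>u\<in>V. \<Sum>v\<in>V. of_bool (R u v) * d u) = (\<Sum>u\<in>V. (d u)\<^sup>2)"
    by (simp add: sum_distrib_right[symmetric] deg[symmetric] power2_eq_square)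
  finally have "2 * (\<Sum>u\<in>V. (d u)\<^sup>2) = (\<Sum>u\<in>V. \<Sum>v\<in>V. of_bool (R u v) * (d u + d v))" by simp
  also have "\<dots> \<le> (\<Sum>u\<in>V. \<Sum>v\<in>V. of_bool (R u v) * (n * (1 + \<mu> / 4))
      + of_bool (u \<in> W \<and> v \<in> W \<and> R u v) * (2 * n))"
    by (intro sum_mono edge)
  also have "\<dots> = S * (n * (1 + \<mu> / 4)) + (\<Sum>u\<in>V. \<Sum>v\<in>V. of_bool (u \<in> W \<and> v \<in> W \<and> R u v)) * (2 * n)"
    by (simp add: sum.distrib sum_distrib_right[symmetric] S_def deg[symmetric])
  also have "(\<Sum>u\<in>V. \<Sum>v\<in>V. of_bool (u \<in> W \<and> v \<in> W \<and> R u v)) = (\<Sum>w\<in>W. real (card (nbrs W R w)))"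
  proof -
    have finW: "finite W" using WV V(1) by (rule finite_subset)
    have "(\<Sum>w\<in>W. real (card (nbrs W R w))) = (\<Sum>u\<in>W. \<Sum>v\<in>W. of_bool (R u v))"
      by (simp add: card_nbrs_sum[OF finW])
    also have "\<dots> = (\<Sum>u\<in>W. \<Sum>v\<in>V. of_bool (u \<in> W \<and> v \<in> W \<and> R u v))"
      using WV V(1) by (intro sum.cong refl sum.mono_neutral_cong_left) auto
    also have "\<dots> = (\<Sum>u\<in>V. \<Sum>v\<in>V. of_bool (u \<in> W \<and> v \<in> W \<and> R u v))"
      using WV V(1) by (intro sum.mono_neutral_left) auto
    finally show ?thesis ..
  qed
  also have "S * (n * (1 + \<mu> / 4)) + (\<Sum>w\<in>W. real (card (nbrs W R w))) * (2 * n)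
      \<le> S * (n * (1 + \<mu> / 4)) + \<mu> / 4 * n\<^sup>2 * (2 * n)"
    using sparse n by (intro add_left_mono mult_right_mono) auto
  finally have sq: "2 * (\<Sum>u\<in>V. (d u)\<^sup>2) \<le> S * (n * (1 + \<mu> / 4)) + \<mu> / 2 * n ^ 3"
    by (simp add: power2_eq_square power3_eq_cube)
  \<comment> \<open>Cauchy-Schwarz, obtained by comparing each \<open>d u\<close> with the mean
    \<open>S / n\<close>.\<close>
  have "(\<Sum>u\<in>V. 2 * (S / n) * d u - (S / n)\<^sup>2) \<le> (\<Sum>u\<in>V. (d u)\<^sup>2)"
  proof (intro sum_mono)
    fix u
    have "0 \<le> (d u - S / n)\<^sup>2" by simp
    then show "2 * (S / n) * d u - (S / n)\<^sup>2 \<le> (d u)\<^sup>2" by (simp add: power2_diff mult_ac)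
  qed
  then have "2 * (S / n) * S - n * (S / n)\<^sup>2 \<le> (\<Sum>u\<in>V. (d u)\<^sup>2)"
    by (simp only: sum_subtractf sum_distrib_left[symmetric] S_def[symmetric] sum_constant n_def[symmetric])
  then have "n * (2 * (S / n) * S - n * (S / n)\<^sup>2) \<le> n * (\<Sum>u\<in>V. (d u)\<^sup>2)"
    using n by (intro mult_left_mono) auto
  moreover have "n * (2 * (S / n) * S - n * (S / n)\<^sup>2) = S\<^sup>2"
    using n by (simp add: field_simps power2_eq_square)
  ultimately have "S\<^sup>2 \<le> n * (\<Sum>u\<in>V. (d u)\<^sup>2)" by simp
  then have "2 * S\<^sup>2 \<le> n * (2 * (\<Sum>u\<in>V. (d u)\<^sup>2))" by simp
  also have "\<dots> \<le> n * (S * (n * (1 + \<mu> / 4)) + \<mu> / 2 * n ^ 3)"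
    using mult_left_mono[OF sq, of n] n by simp
  finally have SS: "2 * S\<^sup>2 \<le> n\<^sup>2 * (1 + \<mu> / 4) * S + \<mu> / 2 * n ^ 4"
    by (simp add: power2_eq_square numeral_eq_Suc algebra_simps)
  \<comment> \<open>Normalising leaves a quadratic inequality in \<open>s\<close> that fails above
    \<open>1 / 2 + \<mu>\<close>.\<close>
  define s where "s = S / n\<^sup>2"
  have S: "S = s * n\<^sup>2" using n by (simp add: s_def)
  have "S \<le> (\<Sum>v\<in>V. n)" unfolding S_def by (intro sum_mono dn)
  then have "s * n\<^sup>2 \<le> 1 * n\<^sup>2" by (simp add: S n_def power2_eq_square)
  then have s1: "s \<le> 1" using n by simp
  have "n ^ 4 * (2 * s\<^sup>2) \<le> n ^ 4 * ((1 + \<mu> / 4) * s + \<mu> / 2)"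
    using SS unfolding S by (simp add: power2_eq_square numeral_eq_Suc algebra_simps)
  then have le: "2 * s\<^sup>2 \<le> (1 + \<mu> / 4) * s + \<mu> / 2" using n by simp
  have "s \<le> 1 / 2 + \<mu>"
  proof (rule ccontr)
    assume "\<not> ?thesis"
    then have gt: "1 / 2 + \<mu> < s" by simp
    then have "s * (1 + 2 * \<mu>) \<le> s * (2 * s)" using \<mu> by (intro mult_left_mono) auto
    moreover have "\<mu> * (1 / 2) \<le> \<mu> * s" using gt \<mu> by (intro mult_left_mono) auto
    moreover have "0 < \<mu> * s" using gt \<mu> by simp
    ultimately show False using le by (simp add: power2_eq_square algebra_simps)
  qed
  then have "S \<le> (1 / 2 + \<mu>) * n\<^sup>2" unfolding S using n by (intro mult_right_mono) auto
  then show ?thesis by (simp add: S_def)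
qed (simp add: n_def)

section \<open>Dense graphs contain the forbidden path\<close>

text \<open>In a simple graph the degree sum is twice the number of edges, hence the leading
  constant \<open>1 / 2\<close>; a list of \<open>7 + j\<close> vertices is a path of length
  \<open>6 + j\<close>.\<close>

lemma dense_graph_has_path:
  fixes \<epsilon> :: real and j :: nat
  assumes \<epsilon>: "\<epsilon> > 0"
  shows "\<exists>N. \<forall>(V :: 'a set) E. finite V \<longrightarrow> N \<le> real (card V) \<longrightarrow>
    (1 / 2 + \<epsilon>) * (real (card V))\<^sup>2 < (\<Sum>v\<in>V. real (card (nbrs V (adj E) v))) \<longrightarrow>
    (\<exists>u\<in>V. \<exists>v\<in>V. u \<noteq> v \<and> card (nbrs V (adj E) u) = card (nbrs V (adj E) v) \<and>
      (\<exists>xs. is_path V E xs \<and> length xs = 7 + j \<and> hd xs = u \<and> last xs = v))"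
proof -
  \<comment> \<open>Both \<open>3 * \<beta>\<close> and \<open>\<beta>\<^sup>2\<close> are at most
    \<open>\<epsilon> / 2\<close>: the deletions allowed by \<open>c\<close> keep the degree sum
    above \<open>(1 / 2 + \<epsilon> / 2) * n\<^sup>2\<close>, which contradicts the bound for
    distinct degrees.\<close>
  define \<beta> where "\<beta> = min (\<epsilon> / 6) (1 / 2)"
  have \<beta>: "\<beta> > 0" "3 * \<beta> \<le> \<epsilon> / 2" "\<beta> \<le> 1" "\<beta> \<le> \<epsilon> / 6" using \<epsilon> by (auto simp: \<beta>_def)
  define c where "c = \<beta>\<^sup>2"
  have c: "c > 0" using \<beta> by (simp add: c_def)
  have "\<beta> * \<beta> \<le> \<beta> * 1" using \<beta> by (intro mult_left_mono) auto
  then have c\<epsilon>: "c \<le> \<epsilon> / 2" using \<beta>(4) \<epsilon> unfolding c_def power2_eq_square by linarith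
  define \<mu> where "\<mu> = \<epsilon> / 2"
  have \<mu>: "\<mu> > 0" using \<epsilon> by (simp add: \<mu>_def)
  \<comment> \<open>The bound of \<open>closed_walks_ge\<close> for \<open>h = \<mu> / 4 * n\<close>
    and \<open>D = \<mu> / 8 * n\<close>, divided by \<open>n ^ (3 + j)\<close>.\<close>
  define \<gamma> where "\<gamma> = (\<mu> / 4)\<^sup>2 * (\<mu> / 8) ^ Suc j"
  have \<gamma>: "\<gamma> > 0" using \<mu> by (simp add: \<gamma>_def)
  obtain N where N: "\<And>(V :: 'a set) E. finite V \<Longrightarrow> real (card V) \<ge> N \<Longrightarrow> \<exists>R. symp R \<and> (\<forall>u v. R u v \<longrightarrow> adj E u v) \<and>
    (\<Sum>u\<in>V. real (card (nbrs V (adj E) u)) - real (card (nbrs V R u))) \<le> c * (real (card V))\<^sup>2 \<and>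
    (\<forall>u\<in>V. \<forall>v\<in>V. \<forall>x\<in>V. \<forall>y\<in>V. u \<noteq> v \<longrightarrow> R u x \<longrightarrow> R y v \<longrightarrow>
      \<gamma> * real (card V) ^ (3 + j) \<le> walks V R (4 + j) x y \<longrightarrow>
      (\<exists>xs. is_path V E xs \<and> length xs = 7 + j \<and> hd xs = u \<and> last xs = v))"
    by (rule exE[OF cleaning[OF \<gamma> c, where 'a = 'a and j = j]], rule that) (elim allE impE, assumption+)
  show ?thesis
  proof (intro exI[of _ "max N (1 / \<beta>)"] allI impI)
    fix V :: "'a set" and E :: "'a set set"
    assume V: "finite V" and NV: "max N (1 / \<beta>) \<le> real (card V)"
    define n where "n = real (card V)"
    define f where "f v = card (nbrs V (adj E) v)" for v
    assume "(1 / 2 + \<epsilon>) * (real (card V))\<^sup>2 < (\<Sum>v\<in>V. real (card (nbrs V (adj E) v)))"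
    then have dense: "(1 / 2 + \<epsilon>) * n\<^sup>2 < (\<Sum>v\<in>V. real (f v))" by (simp add: n_def f_def)
    have n: "1 \<le> \<beta> * n" "n > 0" "N \<le> n"
    proof -
      have "1 / \<beta> \<le> n" "N \<le> n" using NV by (auto simp: n_def)
      then show "1 \<le> \<beta> * n" "N \<le> n" using \<beta> by (auto simp: field_simps)
      have "0 < 1 / \<beta>" using \<beta> by simp
      then show "n > 0" using \<open>1 / \<beta> \<le> n\<close> by linarith
    qed
    then have ne: "V \<noteq> {}" by (auto simp: n_def)
    obtain R where R: "symp R" "\<And>u v. R u v \<Longrightarrow> adj E u v"
      and del: "(\<Sum>v\<in>V. real (f v) - real (card (nbrs V R v))) \<le> c * n\<^sup>2"
      and path: "\<And>u v x y. u \<in> V \<Longrightarrow> v \<in> V \<Longrightarrow> x \<in> V \<Longrightarrow> y \<in> V \<Longrightarrow> u \<noteq> v \<Longrightarrow> R u x \<Longrightarrow> R y v \<Longrightarrow>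
        \<gamma> * n ^ (3 + j) \<le> walks V R (4 + j) x y \<Longrightarrow>
        \<exists>xs. is_path V E xs \<and> length xs = 7 + j \<and> hd xs = u \<and> last xs = v"
      using N[OF V, of E] n(3) unfolding n_def f_def by blast
    have sym: "R a b \<longleftrightarrow> R b a" for a b using R(1) by (blast dest: sympD)
    \<comment> \<open>The vertex \<open>x\<close> is chosen by the degrees \<open>d\<close> in
      \<open>R\<close>, whereas the degrees to be compared are the \<open>f v\<close> of the
      original graph.\<close>
    define d where "d v = card (nbrs V R v)" for v
    have "(\<Sum>v\<in>V. real (f v)) = (\<Sum>v\<in>V. real (f v) - real (d v)) + (\<Sum>v\<in>V. real (d v))"
      by (simp add: sum_subtractf)
    with del dense have "(1 / 2 + \<epsilon>) * n\<^sup>2 < c * n\<^sup>2 + (\<Sum>v\<in>V. real (d v))" by (simp add: d_def)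
    moreover have "c * n\<^sup>2 \<le> \<epsilon> / 2 * n\<^sup>2" using c\<epsilon> by (intro mult_right_mono) auto
    ultimately have densed: "(1 / 2 + \<epsilon> / 2) * n\<^sup>2 < (\<Sum>v\<in>V. real (d v))"
      by (simp add: algebra_simps)
    have "Max (d ` V) \<in> d ` V" using V ne by (intro Max_in) auto
    then obtain x where x: "x \<in> V" "d x = Max (d ` V)" by auto
    have dmax: "d v \<le> d x" if "v \<in> V" for v using that V x(2) by simp
    define W where "W = {w \<in> V. \<mu> / 4 * n \<le> real (card (nbrs V R w \<inter> nbrs V R x))}"
    have many: "\<mu> / 4 * n\<^sup>2 < (\<Sum>w\<in>W. real (card (nbrs W R w)))"
    proof (rule ccontr)
      assume "\<not> ?thesis"
      then have "(\<Sum>v\<in>V. real (d v)) \<le> (1 / 2 + \<mu>) * n\<^sup>2"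
        unfolding n_def d_def using V R(1) \<mu> dmax
        by (intro degree_sum_le_if_sparse[where R = R and x = x and W = W]) (auto simp: W_def n_def d_def)
      with densed show False by (simp add: \<mu>_def)
    qed
    have "(\<mu> / 4 * n)\<^sup>2 * (\<mu> / 8 * n) ^ Suc j \<le> walks V R (4 + j) x x"
    proof (rule closed_walks_ge[where W = W])
      show "\<mu> / 4 * n \<le> walks V R 2 x w" if w: "w \<in> W" for w
      proof -
        have "{y \<in> nbrs V R x. w \<in> nbrs V R y} = nbrs V R w \<inter> nbrs V R x"
          using w sym by (auto simp: W_def mem_nbrs)
        then show ?thesis using w unfolding walks_2[OF V] by (simp add: W_def)
      qed
      have "card W \<le> card V" using V by (intro card_mono) (auto simp: W_def)
      then have "2 * (\<mu> / 8 * n) * real (card W) \<le> 2 * (\<mu> / 8 * n) * n"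
        using \<mu> n by (intro mult_left_mono) (auto simp: n_def)
      also have "\<dots> = \<mu> / 4 * n\<^sup>2" by (simp add: power2_eq_square)
      finally show "2 * (\<mu> / 8 * n) * real (card W) < (\<Sum>w\<in>W. real (card (nbrs W R w)))"
        using many by linarith
    qed (use V R(1) x(1) \<mu> n(2) in \<open>auto simp: W_def\<close>)
    also have "(\<mu> / 4 * n)\<^sup>2 * (\<mu> / 8 * n) ^ Suc j = \<gamma> * n ^ (3 + j)"
      unfolding \<gamma>_def power_mult_distrib by (simp add: power_add power2_eq_square power3_eq_cube)
    finally have closed: "\<gamma> * n ^ (3 + j) \<le> walks V R (4 + j) x x" .
    \<comment> \<open>The closed walks at \<open>x\<close> serve as the middle part for any two
      neighbours of \<open>x\<close>, so two of them with equal \<open>f\<close> suffice.\<close>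
    have "\<not> inj_on f (nbrs V R x)"
    proof
      assume inj: "inj_on f (nbrs V R x)"
      have "(\<Sum>v\<in>V. real (d v)) \<le> (1 / 2 + 3 * \<beta>) * n\<^sup>2"
        unfolding n_def
      proof (rule degree_sum_le_if_distinct[where f = f and C = "nbrs V R x"])
        show "d v \<le> f v" for v
          unfolding d_def f_def using V R(2) by (intro card_mono) (auto simp: mem_nbrs)
        show "d v \<le> card (nbrs V R x)" if "v \<in> V" for v using dmax[OF that] by (simp add: d_def)
      qed (use V \<beta>(1) n(1) inj del nbrs_subset in \<open>simp_all add: n_def d_def c_def\<close>)
      also have "\<dots> \<le> (1 / 2 + \<epsilon> / 2) * n\<^sup>2" using \<beta> by (intro mult_right_mono) auto
      finally show False using densed by linarith
    qed
    then obtain u v where uv: "u \<in> nbrs V R x" "v \<in> nbrs V R x" "u \<noteq> v" "f u = f v"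
      by (auto simp: inj_on_def)
    then have "u \<in> V" "v \<in> V" "R u x" "R x v" using sym by (auto simp: mem_nbrs)
    with path[of u v x x] uv closed x(1)
    show "\<exists>u\<in>V. \<exists>v\<in>V. u \<noteq> v \<and> card (nbrs V (adj E) u) = card (nbrs V (adj E) v) \<and>
      (\<exists>xs. is_path V E xs \<and> length xs = 7 + j \<and> hd xs = u \<and> last xs = v)"
      unfolding f_def by blast
  qed
qed

section \<open>Edge counts and the limit\<close>

lemma degree_eq_card_nbrs:
  assumes "simple_graph V E" "v \<in> V"
  shows "degree E v = card (nbrs V (adj E) v)"
proof -
  have "{e \<in> E. v \<in> e} = (\<lambda>w. {v, w}) ` nbrs V (adj E) v"
  proof
    show "{e \<in> E. v \<in> e} \<subseteq> (\<lambda>w. {v, w}) ` nbrs V (adj E) v"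
    proof
      fix e assume e: "e \<in> {e \<in> E. v \<in> e}"
      then have "e \<subseteq> V" "card e = 2" using assms(1) by (auto simp: simple_graph_def)
      then obtain a b where "e = {a, b}" "a \<in> V" "b \<in> V" by (auto simp: card_2_iff)
      with e show "e \<in> (\<lambda>w. {v, w}) ` nbrs V (adj E) v"
        by (auto simp: mem_nbrs insert_commute)
    qed
  qed (auto simp: mem_nbrs)
  moreover have "inj_on (\<lambda>w. {v, w}) (nbrs V (adj E) v)"
    by (auto simp: inj_on_def doubleton_eq_iff)
  ultimately show ?thesis unfolding degree_def by (simp add: card_image)
qed

lemma handshake:
  assumes "simple_graph V E"
  shows "(\<Sum>v\<in>V. degree E v) = 2 * card E"
proof -
  have V: "finite V" and E: "\<And>e. e \<in> E \<Longrightarrow> e \<subseteq> V \<and> card e = 2"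
    using assms by (auto simp: simple_graph_def)
  have "E \<subseteq> Pow V" using E by blast
  then have finE: "finite E" using V by (meson finite_Pow_iff finite_subset)
  have "(\<Sum>v\<in>V. degree E v) = (\<Sum>v\<in>V. \<Sum>e\<in>E. of_bool (v \<in> e))"
    using finE by (simp add: degree_def of_bool_def sum.If_cases Int_def)
  also have "\<dots> = (\<Sum>e\<in>E. \<Sum>v\<in>V. of_bool (v \<in> e))" by (rule sum.swap)
  also have "\<dots> = (\<Sum>e\<in>E. 2)"
  proof (intro sum.cong refl)
    fix e assume "e \<in> E"
    then have "V \<inter> e = e" "card e = 2" using E by auto
    then show "(\<Sum>v\<in>V. of_bool (v \<in> e)) = (2 :: nat)"
      using V by (simp add: of_bool_def sum.If_cases)
  qed
  finally show ?thesis by simp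
qed

lemma max_edges_le:
  fixes \<epsilon> :: real
  assumes l: "l \<ge> 6" and \<epsilon>: "\<epsilon> > 0"
  shows "\<forall>\<^sub>F n in sequentially. real (max_edges l n) \<le> (1 / 4 + \<epsilon>) * (real n)\<^sup>2"
proof -
  \<comment> \<open>The factor 2 is that of the handshake lemma; \<open>j = l - 6\<close> below
    gives \<open>7 + (l - 6) = l + 1\<close> vertices.\<close>
  have "2 * \<epsilon> > 0" using \<epsilon> by simp
  from dense_graph_has_path[OF this, where 'a = nat and j = "l - 6"]
  obtain N where N: "\<And>(V :: nat set) E. finite V \<Longrightarrow> N \<le> real (card V) \<Longrightarrow>
    (1 / 2 + 2 * \<epsilon>) * (real (card V))\<^sup>2 < (\<Sum>v\<in>V. real (card (nbrs V (adj E) v))) \<Longrightarrow>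
    \<exists>u\<in>V. \<exists>v\<in>V. u \<noteq> v \<and> card (nbrs V (adj E) u) = card (nbrs V (adj E) v) \<and>
      (\<exists>xs. is_path V E xs \<and> length xs = 7 + (l - 6) \<and> hd xs = u \<and> last xs = v)"
    by meson
  have "real (max_edges l n) \<le> (1 / 4 + \<epsilon>) * (real n)\<^sup>2" if n: "N \<le> real n" for n
  proof -
    have "max_edges l n \<in> edge_counts l n"
      unfolding max_edges_def using l by (intro Max_in finite_edge_counts edge_counts_nonempty) simp
    then obtain V :: "nat set" and E where g: "max_edges l n = card E" "simple_graph V E" "card V = n"
      and no: "no_equal_degree_path l V E"
      unfolding edge_counts_def by blast
    have V: "finite V" using g(2) by (simp add: simple_graph_def)
    have "\<not> (1 / 2 + 2 * \<epsilon>) * (real (card V))\<^sup>2 < (\<Sum>v\<in>V. real (card (nbrs V (adj E) v)))"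
    proof
      assume "(1 / 2 + 2 * \<epsilon>) * (real (card V))\<^sup>2 < (\<Sum>v\<in>V. real (card (nbrs V (adj E) v)))"
      from N[OF V _ this] n g(3) obtain u v xs where "u \<in> V" "v \<in> V" "u \<noteq> v"
        "card (nbrs V (adj E) u) = card (nbrs V (adj E) v)"
        "is_path V E xs" "length xs = 7 + (l - 6)" "hd xs = u" "last xs = v"
        by blast
      then have "\<exists>u\<in>V. \<exists>v\<in>V. u \<noteq> v \<and> degree E u = degree E v \<and> joined_by_path V E l u v"
        using l degree_eq_card_nbrs[OF g(2)] unfolding joined_by_path_def path_length_def
        by (intro bexI[of _ u] bexI[of _ v] conjI exI[of _ xs]) auto
      with no show False by (simp add: no_equal_degree_path_def)
    qed
    moreover have "(\<Sum>v\<in>V. real (card (nbrs V (adj E) v))) = real (\<Sum>v\<in>V. degree E v)"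
      using degree_eq_card_nbrs[OF g(2)] by simp
    ultimately show ?thesis
      unfolding handshake[OF g(2)] g(1,3) by (simp add: algebra_simps)
  qed
  then show ?thesis
    using eventually_ge_at_top[of "nat \<lceil>N\<rceil>"] by (elim eventually_mono) (simp add: nat_le_iff ceiling_le_iff)
qed

theorem theorem1p5:
  fixes l :: nat
  assumes "l \<ge> 6"
  shows "\<exists>\<epsilon> :: nat \<Rightarrow> real. \<epsilon> \<longlonglongrightarrow> 0 \<and>
    (\<forall>\<^sub>F n in sequentially. real (max_edges l n) \<le> (1 / 4 + \<epsilon> n) * (real n)\<^sup>2)"
proof (intro exI conjI)
  \<comment> \<open>The least nonnegative error for which the bound holds when \<open>n > 0\<close>;
    it is cut off at 0 because \<open>max_edges_le\<close> bounds the ratio only from above.\<close>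
  define \<epsilon> where "\<epsilon> n = max 0 (real (max_edges l n) / (real n)\<^sup>2 - 1 / 4)" for n
  show "\<epsilon> \<longlonglongrightarrow> 0"
  proof (rule tendstoI)
    fix r :: real assume r: "r > 0"
    have "\<forall>\<^sub>F n in sequentially. real (max_edges l n) \<le> (1 / 4 + r / 2) * (real n)\<^sup>2"
      using assms r by (intro max_edges_le) auto
    then show "\<forall>\<^sub>F n in sequentially. dist (\<epsilon> n) 0 < r"
      using eventually_gt_at_top[of 0]
    proof eventually_elim
      case (elim n)
      then have "real (max_edges l n) / (real n)\<^sup>2 \<le> 1 / 4 + r / 2" by (simp add: divide_le_eq)
      then show ?case using r by (simp add: \<epsilon>_def)
    qed
  qed
  show "\<forall>\<^sub>F n in sequentially. real (max_edges l n) \<le> (1 / 4 + \<epsilon> n) * (real n)\<^sup>2"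
    using eventually_gt_at_top[of 0]
  proof eventually_elim
    case (elim n)
    have "real (max_edges l n) / (real n)\<^sup>2 \<le> 1 / 4 + \<epsilon> n" by (simp add: \<epsilon>_def)
    then show ?case using elim by (simp add: divide_le_eq)
  qed
qed

end
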